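(* For every $1\leq\delta<2$, $\alpha_{*}(\delta,2)\leq \frac{4}{3}\delta$.
   Context: Let $G\sim G(n,\frac12)$ be a random graph on a vertex set $V$ with $|V|=n$; logarithms are base 2. An algorithm accesses $G$ only through edge queries: querying an unordered pair $\{u,v\}$ of distinct vertices reveals whether $\{u,v\}$ is an edge of $G$. An $l$-round algorithm is deterministic and proceeds in $l$ rounds; in round $i$ it submits a set of pairs chosen as a function of the answers received in rounds $1,\dots,i-1$ (but not of answers in round $i$), and all of them are answered together. Let $G'$ be the graph on $V$ whose edges are the queried pairs answered positively. For $l\in\mathbb N$, $0<\delta_i<2$ and $\alpha\le 2$, a $((\delta_1,\dots,\delta_l),l,\alpha)$-algorithm is an $l$-round algorithm making at most $n^{\delta_i}$ queries in round $i$ such that for every sufficiently large $n$, with probability at least $\frac12$ (over $G$), $G'$ contains a clique of size at least $\alpha\log n-o(\log n)$. $\alpha_*((\delta_1,\dots,\delta_l),l)$ is the supremum of $\alpha$ for which such an algorithm exists, and $\alpha_*(\delta,l):=\alpha_*((\delta,\dots,\delta),l)$ (at most $n^\delta$ queries in each of the $l$ rounds), for $1\le\delta<2$. *)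

theory Defs
  imports "HOL-Probability.Probability" "HOL-Probability.Product_PMF" "HOL-Library.Landau_Symbols"
begin

definition vertex_pairs :: "nat \<Rightarrow> nat set set" where
  "vertex_pairs n = {e. e \<subseteq> {..<n} \<and> card e = 2}"

(* A graph on the vertex set {..<n} is represented by its set of edges. *)
definition random_graph :: "nat \<Rightarrow> nat set set pmf" where
  "random_graph n =
     map_pmf (\<lambda>\<omega>. {e \<in> vertex_pairs n. \<omega> e})
       (Pi_pmf (vertex_pairs n) False (\<lambda>_. bernoulli_pmf (1/2)))"

definition is_clique :: "nat set set \<Rightarrow> nat set \<Rightarrow> bool" where
  "is_clique E C \<longleftrightarrow> (\<forall>u\<in>C. \<forall>v\<in>C. u \<noteq> v \<longrightarrow> {u, v} \<in> E)"

(* One entry per completed round: the set of pairs queried and the subset answered positively. *)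
type_synonym transcript = "(nat set set \<times> nat set set) list"

type_synonym strategy = "transcript \<Rightarrow> nat set set"

(* run A E i is the transcript of the first i rounds of A on the graph E. *)
primrec run :: "strategy \<Rightarrow> nat set set \<Rightarrow> nat \<Rightarrow> transcript" where
  "run A E 0 = []"
| "run A E (Suc i) = run A E i @ [(A (run A E i), A (run A E i) \<inter> E)]"

(* Rounds are numbered from 0, so this is the set submitted in round i + 1. *)
definition queries :: "strategy \<Rightarrow> nat set set \<Rightarrow> nat \<Rightarrow> nat set set" where
  "queries A E i = A (run A E i)"

definition revealed_graph :: "strategy \<Rightarrow> nat set set \<Rightarrow> nat \<Rightarrow> nat set set" where
  "revealed_graph A E l = (\<Union>i<l. queries A E i \<inter> E)"

(* A n is the strategy used on n vertices; h is the o(log n) error term. *)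
definition clique_algorithm ::
    "real list \<Rightarrow> nat \<Rightarrow> real \<Rightarrow> (nat \<Rightarrow> strategy) \<Rightarrow> bool" where
  "clique_algorithm \<delta>s l \<alpha> A \<longleftrightarrow>
     length \<delta>s = l \<and> (\<forall>i<l. 0 < \<delta>s ! i \<and> \<delta>s ! i < 2) \<and> \<alpha> \<le> 2 \<and>
     (\<forall>n. \<forall>E \<subseteq> vertex_pairs n. \<forall>i<l.
        queries (A n) E i \<subseteq> vertex_pairs n \<and>
        real (card (queries (A n) E i)) \<le> real n powr (\<delta>s ! i)) \<and>
     (\<exists>h \<in> o(\<lambda>n. log 2 (real n)). \<forall>\<^sub>F n in sequentially.
        measure_pmf.prob (random_graph n)
          {E. \<exists>C \<subseteq> {..<n}. is_clique (revealed_graph (A n) E l) C \<and>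
                real (card C) \<ge> \<alpha> * log 2 (real n) - h n} \<ge> 1/2)"

definition alpha_star :: "real list \<Rightarrow> nat \<Rightarrow> real" where
  "alpha_star \<delta>s l = Sup {\<alpha>. \<exists>A. clique_algorithm \<delta>s l \<alpha> A}"

definition alpha_star_uniform :: "real \<Rightarrow> nat \<Rightarrow> real" where
  "alpha_star_uniform \<delta> l = alpha_star (replicate l \<delta>) l"

(* The supremum in alpha_star is taken over a nonempty set bounded above, so the
   real-valued Sup is the true supremum. *)
lemma bdd_above_clique_algorithm: "bdd_above {\<alpha>. \<exists>A. clique_algorithm \<delta>s l \<alpha> A}"
  by (rule bdd_aboveI[of _ 2]) (auto simp: clique_algorithm_def)

lemma clique_algorithm_zero:
  assumes "length \<delta>s = l" "\<forall>i<l. 0 < \<delta>s ! i \<and> \<delta>s ! i < 2"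
  shows "clique_algorithm \<delta>s l 0 (\<lambda>_ _. {})"
proof -
  have 1: "{E. \<exists>C \<subseteq> {..<n}. is_clique (revealed_graph (\<lambda>_. {}) E l) C \<and>
              real (card C) \<ge> 0 * log 2 (real n) - 0} = UNIV" for n
    by (auto simp: is_clique_def intro!: exI[of _ "{}"])
  have "(\<lambda>_. 0) \<in> o(\<lambda>n. log 2 (real n))"
    by simp
  moreover have "\<forall>\<^sub>F n in sequentially. measure_pmf.prob (random_graph n)
      {E. \<exists>C \<subseteq> {..<n}. is_clique (revealed_graph (\<lambda>_. {}) E l) C \<and>
            real (card C) \<ge> 0 * log 2 (real n) - 0} \<ge> 1/2"
    unfolding 1 by simp
  ultimately show ?thesis
    unfolding clique_algorithm_def using assms
    by (intro conjI bexI[of _ "\<lambda>_. 0"]) (auto simp: queries_def)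
qed

end

theory Submission
  imports Defs "HOL-Real_Asymp.Real_Asymp"
begin

text \<open>
  Write \<open>N = log 2 n\<close>, let \<open>Q\<close> be the (deterministic) set of first-round queries and let \<open>C\<close> be a clique of size
  \<open>k > (4/3 \<delta> + \<gamma>) N\<close> in the revealed graph. For \<open>z \<le> \<delta>/2\<close> at most \<open>2 n\<^sup>z\<close> vertices, the heavy ones, have
  \<open>Q\<close>-degree at least \<open>n\<close> to the power \<open>\<delta> - z\<close>. Choose \<open>z = \<delta>/2 - m\<close> as the point where the number \<open>l\<close> of heavy
  vertices of \<open>C\<close> crosses \<open>m N\<close>. Split \<open>C\<close> into its heavy vertices, its vertices of degree at least \<open>n\<close> to the power
  \<open>\<delta>/2\<close>, a maximal \<open>Q\<close>-matching of the rest, and a \<open>Q\<close>-independent remainder \<open>T\<^sub>0\<close>; let \<open>T\<close> be the part of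
  \<open>T\<^sub>0\<close> whose \<open>Q\<close>-neighbours in \<open>C\<close> are all heavy. In powers of \<open>n\<close>, a heavy vertex costs \<open>\<delta>/2 - m\<close>, a vertex of
  \<open>T\<^sub>0 - T\<close> is a neighbour of a non-heavy vertex and costs \<open>\<delta>/2 + m\<close>, and every other vertex costs \<open>\<delta>/2\<close> on
  average (those of \<open>T\<close> because they form a clique of second-round queries). At most \<open>m N |T|\<close> pairs meeting \<open>T\<close> are
  queried in round one. Hence the expected number of such configurations is at most \<open>n\<close> to the power
  \<open>\<delta> k/2 - m l + m |T\<^sub>0| - k\<^sup>2/(2 N) + o(N)\<close>. Here \<open>l \<ge> m N\<close>, and first-moment bounds for cliques of heavy
  vertices and for \<open>Q\<close>-independent cliques give \<open>l \<le> 2 z N + o(N)\<close>, so \<open>m \<le> \<delta>/3 + o(1)\<close>, and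
  \<open>|T\<^sub>0| \<le> \<delta> N + o(N)\<close>. So \<open>m |T\<^sub>0| - m l\<close> is at most \<open>2/9 \<delta>\<^sup>2 N + o(N)\<close> and the exponent is negative.
\<close>

subsection \<open>Counting cliques and two-round configurations\<close>

definition pairs_in :: "'a set \<Rightarrow> 'a set set" where
  "pairs_in X = {e. e \<subseteq> X \<and> card e = 2}"

lemma vertex_pairs_eq: "vertex_pairs n = pairs_in {..<n}"
  by (simp add: vertex_pairs_def pairs_in_def)

lemma finite_pairs_in [simp]: "finite X \<Longrightarrow> finite (pairs_in X)"
  by (rule finite_subset[of _ "Pow X"]) (auto simp: pairs_in_def)

lemma pairs_in_mono: "X \<subseteq> Y \<Longrightarrow> pairs_in X \<subseteq> pairs_in Y"
  by (auto simp: pairs_in_def)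

lemma card_pairs_in: "finite X \<Longrightarrow> card (pairs_in X) = card X choose 2"
  unfolding pairs_in_def by (rule n_subsets)

lemma doubleton_in_pairs_in: "u \<in> X \<Longrightarrow> v \<in> X \<Longrightarrow> u \<noteq> v \<Longrightarrow> {u, v} \<in> pairs_in X"
  by (auto simp: pairs_in_def)

lemma pairs_in_Un_cases:
  assumes "e \<in> pairs_in (W \<union> T)"
  shows "e \<in> pairs_in W \<or> e \<in> pairs_in T \<or> (\<exists>u\<in>W. \<exists>v\<in>T. e = {u, v})"
proof -
  obtain x y where "e = {x, y}" "x \<noteq> y" "x \<in> W \<union> T" "y \<in> W \<union> T"
    using assms by (auto simp: pairs_in_def card_2_iff)
  then show ?thesis
    by (auto simp: pairs_in_def)
qed

section \<open>Vertex sets of matchings, and counting cliques through them\<close>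

text \<open>The vertex sets of matchings with \<open>p\<close> pairs from \<open>Q\<close>. Only the
  covered vertices are kept, because the counting needs just the number of such sets and their
  size.\<close>

primrec matched_sets :: "'a set set \<Rightarrow> nat \<Rightarrow> 'a set set" where
  "matched_sets Q 0 = {{}}"
| "matched_sets Q (Suc p) = {X \<union> e | X e. X \<in> matched_sets Q p \<and> e \<in> Q \<and> X \<inter> e = {}}"

lemma matched_sets_Suc_subset:
  "matched_sets Q (Suc p) \<subseteq> (\<lambda>(X, e). X \<union> e) ` (matched_sets Q p \<times> Q)"
  by auto

lemma finite_matched_sets: "finite Q \<Longrightarrow> finite (matched_sets Q p)"
proof (induction p)
  case (Suc p)
  then show ?case
    by (intro finite_subset[OF matched_sets_Suc_subset]) auto
qed simp

text \<open>The pairs are chosen one after the other. For \<open>Q\<close> of size at most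
  \<open>n powr \<delta>\<close> this is a cost of \<delta>/2 per vertex, in powers of n.\<close>

lemma card_matched_sets_le: "finite Q \<Longrightarrow> card (matched_sets Q p) \<le> card Q ^ p"
proof (induction p)
  case (Suc p)
  have fin: "finite (matched_sets Q p \<times> Q)"
    using Suc.prems finite_matched_sets by auto
  have "card (matched_sets Q (Suc p)) \<le> card (matched_sets Q p \<times> Q)"
    using card_mono[OF _ matched_sets_Suc_subset, of Q p] card_image_le[OF fin, of "\<lambda>(X, e). X \<union> e"] fin
    by (meson finite_imageI le_trans)
  also have "\<dots> \<le> card Q ^ p * card Q"
    using Suc by (simp add: card_cartesian_product)
  finally show ?case
    by (simp add: mult.commute)
qed simp

lemma card_of_matched_set:
  assumes "\<forall>e\<in>Q. card e = 2" and "X \<in> matched_sets Q p"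
  shows "finite X \<and> card X = 2 * p"
  using assms(2)
proof (induction p arbitrary: X)
  case (Suc p)
  then obtain Y e where Y: "X = Y \<union> e" "Y \<in> matched_sets Q p" "e \<in> Q" "Y \<inter> e = {}"
    by auto
  moreover have "card e = 2" "finite e"
    using assms(1) Y(3) by (auto intro: card_ge_0_finite)
  ultimately show ?case
    using Suc.IH[of Y] by (auto simp: card_Un_disjoint)
qed simp

text \<open>A clique of even size has a perfect matching: after splitting off any pair, the rest is
  again a clique.\<close>

lemma clique_in_matched_sets:
  assumes "finite T" "card T = 2 * p" "pairs_in T \<subseteq> Q"
  shows "T \<in> matched_sets Q p"
  using assms
proof (induction p arbitrary: T)
  case (Suc p)
  have "\<exists>e\<subseteq>T. card e = 2"
    using obtain_subset_with_card_n[of 2 T] Suc.prems by (metis le_add1 mult_Suc_right)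
  then obtain e where e: "e \<subseteq> T" "card e = 2"
    by blast
  then have fe: "finite e"
    using Suc.prems(1) finite_subset by blast
  have "T - e \<in> matched_sets Q p"
  proof (rule Suc.IH)
    show "card (T - e) = 2 * p"
      using Suc.prems e fe by (simp add: card_Diff_subset)
    show "pairs_in (T - e) \<subseteq> Q"
      using Suc.prems(3) pairs_in_mono[of "T - e" T] by blast
  qed (use Suc.prems in auto)
  moreover have "e \<in> Q"
    using e Suc.prems(3) by (auto simp: pairs_in_def)
  moreover have "T = (T - e) \<union> e"
    using e by auto
  moreover have "(T - e) \<inter> e = {}"
    by auto
  ultimately show ?case
    unfolding matched_sets.simps by blast
qed simp

text \<open>A perfect matching determines the clique when \<open>t\<close> is even; when
  \<open>t\<close> is odd, one vertex is chosen separately, and the factor \<open>card V\<close>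
  pays for it.\<close>

lemma card_cliques_le:
  assumes "finite V" "V \<noteq> {}" "finite Q"
  shows "card {T. T \<subseteq> V \<and> card T = t \<and> pairs_in T \<subseteq> Q} \<le> card V * card Q ^ (t div 2)"
    (is "card ?S \<le> _")
proof (cases "even t")
  case True
  have "?S \<subseteq> matched_sets Q (t div 2)"
    using True assms(1) by (auto intro!: clique_in_matched_sets dest: finite_subset)
  then have "card ?S \<le> card Q ^ (t div 2)"
    using card_mono[OF finite_matched_sets[OF assms(3)]] card_matched_sets_le[OF assms(3)]
    by (meson le_trans)
  also have "\<dots> \<le> card V * card Q ^ (t div 2)"
    using assms by (simp add: Suc_leI card_gt_0_iff)
  finally show ?thesis .
next
  case False
  let ?M = "V \<times> matched_sets Q (t div 2)"
  have fin: "finite ?M"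
    using assms finite_matched_sets by blast
  have "?S \<subseteq> (\<lambda>(v, X). insert v X) ` ?M"
  proof
    fix T assume T: "T \<in> ?S"
    have fT: "finite T"
      using T assms(1) finite_subset by blast
    obtain v where v: "v \<in> T"
      using T False by fastforce
    have "T - {v} \<in> matched_sets Q (t div 2)"
    proof (rule clique_in_matched_sets)
      show "card (T - {v}) = 2 * (t div 2)"
        using T v False fT by auto
      show "pairs_in (T - {v}) \<subseteq> Q"
        using T pairs_in_mono[of "T - {v}" T] by blast
    qed (use fT in auto)
    then show "T \<in> (\<lambda>(v, X). insert v X) ` ?M"
      using v T by (intro image_eqI[of _ _ "(v, T - {v})"]) auto
  qed
  then have "card ?S \<le> card ?M"
    using fin by (meson card_image_le card_mono finite_imageI le_trans)
  also have "\<dots> \<le> card V * card Q ^ (t div 2)"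
    using card_matched_sets_le[OF assms(3)] by (simp add: card_cartesian_product)
  finally show ?thesis .
qed

text \<open>Greedy choice: remove a pair of \<open>Q\<close> as long as the remaining vertices
  contain one.\<close>

lemma exists_maximal_matched_set:
  assumes "finite Y" and "\<forall>e\<in>Q. card e = 2"
  shows "\<exists>p. \<exists>X \<in> matched_sets Q p. X \<subseteq> Y \<and> pairs_in (Y - X) \<inter> Q = {}"
  using assms(1)
proof (induction Y rule: finite_psubset_induct)
  case (psubset Y)
  show ?case
  proof (cases "pairs_in Y \<inter> Q = {}")
    case True
    then show ?thesis
      by (intro exI[of _ 0]) auto
  next
    case False
    then obtain e where e: "e \<in> Q" "e \<subseteq> Y" "card e = 2"
      by (auto simp: pairs_in_def)
    have "e \<noteq> {}"
      using e(3) by auto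
    then have "Y - e \<subset> Y"
      using e(2) by blast
    then obtain p X where X: "X \<in> matched_sets Q p" "X \<subseteq> Y - e" "pairs_in (Y - e - X) \<inter> Q = {}"
      using psubset.IH by blast
    have "X \<union> e \<in> matched_sets Q (Suc p)"
      using X e by auto
    moreover have "Y - (X \<union> e) = Y - e - X"
      by auto
    ultimately show ?thesis
      using X e by (intro exI[of _ "Suc p"] bexI[of _ "X \<union> e"]) auto
  qed
qed

section \<open>Degrees in the query graph\<close>

definition degree_in :: "'a set set \<Rightarrow> 'a \<Rightarrow> nat" where
  "degree_in Q v = card {e \<in> Q. v \<in> e}"

lemma sum_degree_in_le:
  assumes "finite S" "finite Q" "\<forall>e\<in>Q. card e = 2"
  shows "(\<Sum>v\<in>S. degree_in Q v) \<le> 2 * card Q"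
proof -
  have "(\<Sum>v\<in>S. degree_in Q v) = (\<Sum>v\<in>S. \<Sum>e\<in>{e \<in> Q. v \<in> e}. 1)"
    by (simp add: degree_in_def)
  also have "\<dots> = (\<Sum>e\<in>Q. \<Sum>v\<in>{v \<in> S. v \<in> e}. 1)"
    by (rule sum.swap_restrict[OF assms(1,2)])
  also have "\<dots> \<le> (\<Sum>e\<in>Q. 2)"
  proof (rule sum_mono)
    fix e assume "e \<in> Q"
    then have "card e = 2" "finite e"
      using assms(3) by (auto intro: card_ge_0_finite)
    then show "(\<Sum>v\<in>{v \<in> S. v \<in> e}. 1) \<le> (2::nat)"
      using card_mono[of e "{v \<in> S. v \<in> e}"] by auto
  qed
  finally show ?thesis
    by simp
qed

lemma card_neighbours_le:
  assumes "finite Q"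
  shows "finite {v. {u, v} \<in> Q}" "card {v. {u, v} \<in> Q} \<le> degree_in Q u"
proof -
  have inj: "inj_on (\<lambda>v. {u, v}) {v. {u, v} \<in> Q}"
    by (auto simp: inj_on_def doubleton_eq_iff)
  have sub: "(\<lambda>v. {u, v}) ` {v. {u, v} \<in> Q} \<subseteq> {e \<in> Q. u \<in> e}"
    by auto
  show "finite {v. {u, v} \<in> Q}"
    using finite_subset[OF sub] assms by (intro finite_imageD[OF _ inj]) auto
  show "card {v. {u, v} \<in> Q} \<le> degree_in Q u"
    unfolding degree_in_def using card_inj_on_le[OF inj sub] assms by simp
qed

section \<open>Counting graphs over the two rounds\<close>

text \<open>A uniform subset of \<open>B\<close> contains \<open>A\<close> with probability 2 to the
  power \<open>- card A\<close>; the product form keeps this in the naturals.\<close>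

lemma card_between:
  assumes "finite B" "A \<subseteq> B"
  shows "card {E. A \<subseteq> E \<and> E \<subseteq> B} * 2 ^ card A = 2 ^ card B"
proof -
  have "bij_betw (\<lambda>Z. A \<union> Z) (Pow (B - A)) {E. A \<subseteq> E \<and> E \<subseteq> B}"
    by (rule bij_betwI[where g = "\<lambda>E. E - A"]) (use assms in auto)
  then have "card {E. A \<subseteq> E \<and> E \<subseteq> B} = 2 ^ card (B - A)"
    using assms by (metis bij_betw_same_card card_Pow finite_Diff)
  moreover have "card B = card (B - A) + card A"
    using assms by (metis card_Diff_subset card_mono finite_subset le_add_diff_inverse2)
  ultimately show ?thesis
    by (simp add: power_add)
qed

text \<open>\<open>F\<close> stands for the positive first-round answers, \<open>W\<close> for the
  part of the clique that is enumerated in advance, and \<open>T\<close> for the part that is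
  counted through the second-round queries \<open>q2 F\<close>. The bound \<open>d\<close> limits
  the first-round pairs between \<open>W\<close> and \<open>T\<close>.\<close>

definition second_round_extension ::
    "'a set set \<Rightarrow> ('a set set \<Rightarrow> 'a set set) \<Rightarrow> 'a set \<Rightarrow> nat \<Rightarrow> nat \<Rightarrow> 'a set set \<Rightarrow> 'a set \<Rightarrow> 'a set \<Rightarrow> bool" where
  "second_round_extension Q q2 V t d F W T \<longleftrightarrow>
     T \<subseteq> V \<and> card T = t \<and> W \<inter> T = {} \<and> pairs_in T \<subseteq> q2 F \<and> pairs_in T \<inter> Q = {} \<and>
     (\<forall>v\<in>T. card {u \<in> W. {u, v} \<in> Q} \<le> d)"

text \<open>Since \<open>T\<close> contains no first-round pair, each pair of
  \<open>W \<union> T\<close> lies outside \<open>Q\<close>, or in \<open>Q\<close> and inside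
  \<open>W\<close>, or in \<open>Q\<close> and between \<open>W\<close> and \<open>T\<close>. The
  last kind occurs at most \<open>d\<close> times per vertex of \<open>T\<close>.\<close>

lemma unqueried_pairs_ge:
  assumes "finite V" "W \<subseteq> V" "second_round_extension Q q2 V t d F W T"
  shows "(card W + t) choose 2 \<le> card (pairs_in (W \<union> T) - Q) + card (pairs_in W \<inter> Q) + d * t"
proof -
  have T: "T \<subseteq> V" "card T = t" "W \<inter> T = {}" "pairs_in T \<inter> Q = {}"
      "\<And>v. v \<in> T \<Longrightarrow> card {u \<in> W. {u, v} \<in> Q} \<le> d"
    using assms(3) by (auto simp: second_round_extension_def)
  have fin: "finite W" "finite T"
    using assms T finite_subset by blast+
  let ?X = "\<Union>v\<in>T. (\<lambda>u. {u, v}) ` {u \<in> W. {u, v} \<in> Q}"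
  have "card ?X \<le> (\<Sum>v\<in>T. card ((\<lambda>u. {u, v}) ` {u \<in> W. {u, v} \<in> Q}))"
    by (rule card_UN_le[OF fin(2)])
  also have "\<dots> \<le> (\<Sum>v\<in>T. d)"
  proof (rule sum_mono)
    fix v assume v: "v \<in> T"
    have "card ((\<lambda>u. {u, v}) ` {u \<in> W. {u, v} \<in> Q}) \<le> card {u \<in> W. {u, v} \<in> Q}"
      using fin by (intro card_image_le) auto
    then show "card ((\<lambda>u. {u, v}) ` {u \<in> W. {u, v} \<in> Q}) \<le> d"
      using T(5)[OF v] by simp
  qed
  finally have X: "card ?X \<le> d * t"
    using T(2) by (simp add: mult.commute)
  have "pairs_in (W \<union> T) \<subseteq> (pairs_in (W \<union> T) - Q) \<union> (pairs_in W \<inter> Q) \<union> ?X"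
    using T(4) pairs_in_Un_cases[of _ W T] by fast
  then have "card (pairs_in (W \<union> T)) \<le> card ((pairs_in (W \<union> T) - Q) \<union> (pairs_in W \<inter> Q) \<union> ?X)"
    using fin by (intro card_mono) auto
  also have "\<dots> \<le> card (pairs_in (W \<union> T) - Q) + card (pairs_in W \<inter> Q) + card ?X"
    by (meson add_le_mono card_Un_le le_refl le_trans)
  finally have "card (pairs_in (W \<union> T)) \<le> card (pairs_in (W \<union> T) - Q) + card (pairs_in W \<inter> Q) + d * t"
    using X by linarith
  moreover have "card (pairs_in (W \<union> T)) = (card W + t) choose 2"
    using fin T by (simp add: card_pairs_in card_Un_disjoint)
  ultimately show ?thesis
    by simp
qed

text \<open>
  The second-round queries depend on the first-round answers only, so the two rounds can be counted one after the other.
  The first-round pairs inside \<open>W\<close> are paid for in round one and all unqueried pairs in round two; only the at most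
  \<open>d * t\<close> first-round pairs between \<open>W\<close> and \<open>T\<close> are lost.
\<close>
lemma card_two_round_le:
  fixes Q :: "'a set set"
  assumes V: "finite V" and Q: "Q \<subseteq> pairs_in V"
    and B: "\<And>F. F \<subseteq> Q \<Longrightarrow> card {T. T \<subseteq> V \<and> card T = t \<and> pairs_in T \<subseteq> q2 F} \<le> B"
    and fam: "finite \<W>" "\<And>W. W \<in> \<W> \<Longrightarrow> W \<subseteq> V \<and> card W = w"
  shows "card {E. E \<subseteq> pairs_in V \<and> (\<exists>W\<in>\<W>. \<exists>T. second_round_extension Q q2 V t d (E \<inter> Q) W T \<and>
             pairs_in (W \<union> T) \<subseteq> E)} * 2 ^ ((w + t) choose 2)
         \<le> card \<W> * (B * 2 ^ (d * t) * 2 ^ card (pairs_in V))" (is "card ?bad * ?c \<le> _")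
proof -
  let ?P = "pairs_in V"
  let ?ext = "\<lambda>W F. {T. second_round_extension Q q2 V t d F W T}"
  let ?first = "\<lambda>W. {F. pairs_in W \<inter> Q \<subseteq> F \<and> F \<subseteq> Q}"
  let ?S = "\<lambda>W F T. {E. E \<subseteq> ?P \<and> E \<inter> Q = F \<and> pairs_in (W \<union> T) - Q \<subseteq> E}"
  have finP: "finite ?P" and finQ: "finite Q"
    using V Q by (auto intro: finite_subset)
  have finS: "finite (?S W F T)" for W F T
    using finP by (auto intro: finite_subset[of _ "Pow ?P"])
  have fin_ext: "finite (?ext W F)" for W F
    using V by (auto simp: second_round_extension_def intro: finite_subset[of _ "Pow V"])
  have fin_first: "finite (?first W)" for W
    using finQ by (auto intro: finite_subset[of _ "Pow Q"])

  \<comment> \<open>With the answers on \<open>Q\<close> fixed to \<open>F\<close>, only pairs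
    outside \<open>Q\<close> are free, and those inside \<open>W \<union> T\<close> are forced. The
    factor \<open>2 ^ card (pairs_in W \<inter> Q)\<close> is a debt that \<open>round1\<close>
    settles.\<close>
  have single: "card (?S W F T) * ?c \<le> 2 ^ card (?P - Q) * 2 ^ card (pairs_in W \<inter> Q) * 2 ^ (d * t)"
    if W: "W \<in> \<W>" and T: "T \<in> ?ext W F" for W F T
  proof -
    let ?H = "pairs_in (W \<union> T) - Q"
    have WV: "W \<subseteq> V" "card W = w" "T \<subseteq> V"
      using fam(2)[OF W] T by (auto simp: second_round_extension_def)
    have HP: "?H \<subseteq> ?P - Q"
      using pairs_in_mono[of "W \<union> T" V] WV by auto
    have "card (?S W F T) \<le> card {Z. ?H \<subseteq> Z \<and> Z \<subseteq> ?P - Q}"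
    proof (rule card_inj_on_le[of "\<lambda>E. E - Q"])
      show "inj_on (\<lambda>E. E - Q) (?S W F T)"
        by (rule inj_onI) blast
      show "finite {Z. ?H \<subseteq> Z \<and> Z \<subseteq> ?P - Q}"
        using finP by (auto intro: finite_subset[of _ "Pow ?P"])
    qed auto
    then have "card (?S W F T) * 2 ^ card ?H \<le> card {Z. ?H \<subseteq> Z \<and> Z \<subseteq> ?P - Q} * 2 ^ card ?H"
      by (rule mult_le_mono1)
    also have "\<dots> = 2 ^ card (?P - Q)"
      using finP by (intro card_between HP) auto
    finally have *: "card (?S W F T) * 2 ^ card ?H \<le> 2 ^ card (?P - Q)" .
    have "?c \<le> 2 ^ (card ?H + card (pairs_in W \<inter> Q) + d * t)"
      using unqueried_pairs_ge[OF V WV(1), of Q q2 t d F T] T WV by (intro power_increasing) auto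
    then have "card (?S W F T) * ?c \<le> card (?S W F T) * (2 ^ card ?H * 2 ^ card (pairs_in W \<inter> Q) * 2 ^ (d * t))"
      by (simp add: power_add)
    also have "\<dots> = (card (?S W F T) * 2 ^ card ?H) * 2 ^ card (pairs_in W \<inter> Q) * 2 ^ (d * t)"
      by (simp only: mult.assoc)
    also have "\<dots> \<le> 2 ^ card (?P - Q) * 2 ^ card (pairs_in W \<inter> Q) * 2 ^ (d * t)"
      by (intro mult_le_mono1 *)
    finally show ?thesis .
  qed

  \<comment> \<open>The sets \<open>T\<close> are cliques of \<open>q2 F\<close>, and
    \<open>F\<close> is fixed here, so at most \<open>B\<close> of them occur.\<close>
  have round2: "card (\<Union>T\<in>?ext W F. ?S W F T) * ?c
      \<le> B * (2 ^ card (?P - Q) * 2 ^ card (pairs_in W \<inter> Q) * 2 ^ (d * t))"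
    if W: "W \<in> \<W>" and F: "F \<in> ?first W" for W F
  proof -
    have "card (\<Union>T\<in>?ext W F. ?S W F T) * ?c \<le> (\<Sum>T\<in>?ext W F. card (?S W F T)) * ?c"
      by (intro mult_le_mono1 card_UN_le fin_ext)
    also have "\<dots> = (\<Sum>T\<in>?ext W F. card (?S W F T) * ?c)"
      by (rule sum_distrib_right)
    also have "\<dots> \<le> card (?ext W F) * (2 ^ card (?P - Q) * 2 ^ card (pairs_in W \<inter> Q) * 2 ^ (d * t))"
      using sum_bounded_above[of "?ext W F" "\<lambda>T. card (?S W F T) * ?c", OF single[OF W]] by simp
    also have "card (?ext W F) \<le> B"
    proof -
      have "finite {T. T \<subseteq> V \<and> card T = t \<and> pairs_in T \<subseteq> q2 F}"
        using V by (auto intro: finite_subset[of _ "Pow V"])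
      then have "card (?ext W F) \<le> card {T. T \<subseteq> V \<and> card T = t \<and> pairs_in T \<subseteq> q2 F}"
        by (intro card_mono) (auto simp: second_round_extension_def)
      also have "\<dots> \<le> B"
        using F by (intro B) auto
      finally show ?thesis .
    qed
    finally show ?thesis
      by (simp add: mult_le_mono1)
  qed

  have PQ: "2 ^ card (?P - Q) * 2 ^ card Q = (2::nat) ^ card ?P"
    using Q finP finQ by (simp add: card_Diff_subset card_mono flip: power_add)

  \<comment> \<open>\<open>F\<close> must contain the first-round pairs inside \<open>W\<close>; by
    \<open>card_between\<close> this restriction on \<open>F\<close> cancels the debt from
    \<open>single\<close> exactly.\<close>
  have round1: "card (\<Union>F\<in>?first W. \<Union>T\<in>?ext W F. ?S W F T) * ?c \<le> B * 2 ^ (d * t) * 2 ^ card ?P"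
    if W: "W \<in> \<W>" for W
  proof -
    have "card (\<Union>F\<in>?first W. \<Union>T\<in>?ext W F. ?S W F T) * ?c
        \<le> (\<Sum>F\<in>?first W. card (\<Union>T\<in>?ext W F. ?S W F T)) * ?c"
      by (intro mult_le_mono1 card_UN_le fin_first)
    also have "\<dots> = (\<Sum>F\<in>?first W. card (\<Union>T\<in>?ext W F. ?S W F T) * ?c)"
      by (rule sum_distrib_right)
    also have "\<dots> \<le> card (?first W) * (B * (2 ^ card (?P - Q) * 2 ^ card (pairs_in W \<inter> Q) * 2 ^ (d * t)))"
      using sum_bounded_above[of "?first W" "\<lambda>F. card (\<Union>T\<in>?ext W F. ?S W F T) * ?c", OF round2[OF W]]
      by simp
    also have "\<dots> = (card (?first W) * 2 ^ card (pairs_in W \<inter> Q)) * (B * (2 ^ card (?P - Q) * 2 ^ (d * t)))"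
      by (simp only: ac_simps)
    also have "card (?first W) * 2 ^ card (pairs_in W \<inter> Q) = 2 ^ card Q"
      using finQ by (intro card_between) auto
    also have "2 ^ card Q * (B * (2 ^ card (?P - Q) * 2 ^ (d * t)))
        = B * 2 ^ (d * t) * (2 ^ card (?P - Q) * 2 ^ card Q)"
      by (simp only: ac_simps)
    finally show ?thesis
      by (simp only: PQ)
  qed

  have "?bad \<subseteq> (\<Union>W\<in>\<W>. \<Union>F\<in>?first W. \<Union>T\<in>?ext W F. ?S W F T)"
  proof
    fix E assume "E \<in> ?bad"
    then obtain W T where E: "E \<subseteq> ?P" "W \<in> \<W>" "second_round_extension Q q2 V t d (E \<inter> Q) W T"
        "pairs_in (W \<union> T) \<subseteq> E"
      by auto
    moreover have "pairs_in W \<subseteq> E"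
      using E(4) pairs_in_mono[of W "W \<union> T"] by auto
    ultimately show "E \<in> (\<Union>W\<in>\<W>. \<Union>F\<in>?first W. \<Union>T\<in>?ext W F. ?S W F T)"
      by (intro UN_I[of W] UN_I[of "E \<inter> Q"] UN_I[of T]) auto
  qed
  then have "card ?bad \<le> card (\<Union>W\<in>\<W>. \<Union>F\<in>?first W. \<Union>T\<in>?ext W F. ?S W F T)"
    using fam(1) fin_first fin_ext finS by (intro card_mono) auto
  also have "\<dots> \<le> (\<Sum>W\<in>\<W>. card (\<Union>F\<in>?first W. \<Union>T\<in>?ext W F. ?S W F T))"
    by (rule card_UN_le[OF fam(1)])
  finally have "card ?bad * ?c \<le> (\<Sum>W\<in>\<W>. card (\<Union>F\<in>?first W. \<Union>T\<in>?ext W F. ?S W F T)) * ?c"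
    by (rule mult_le_mono1)
  also have "\<dots> = (\<Sum>W\<in>\<W>. card (\<Union>F\<in>?first W. \<Union>T\<in>?ext W F. ?S W F T) * ?c)"
    by (rule sum_distrib_right)
  also have "\<dots> \<le> card \<W> * (B * 2 ^ (d * t) * 2 ^ card ?P)"
    using sum_bounded_above[of \<W> "\<lambda>W. card (\<Union>F\<in>?first W. \<Union>T\<in>?ext W F. ?S W F T) * ?c", OF round1]
    by simp
  finally show ?thesis .
qed

subsection \<open>Heavy vertices and the decomposition of a clique\<close>

lemma card_subsets_le_power:
  assumes "finite S"
  shows "card {R. R \<subseteq> S \<and> card R = r} \<le> card S ^ r"
proof (cases "r \<le> card S")
  case True
  then show ?thesis
    using assms by (simp add: n_subsets binomial_le_pow)
next
  case False
  then show ?thesis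
    using assms by (simp add: n_subsets binomial_eq_0)
qed

lemma real_choose_two: "real (k choose 2) = real k * (real k - 1) / 2"
  by (cases k) (auto simp: choose_two real_of_nat_div field_simps)

lemma random_graph_eq: "random_graph n = pmf_of_set (Pow (vertex_pairs n))"
  unfolding random_graph_def vertex_pairs_eq by (rule pmf_of_set_Pow_conv_bernoulli) simp

section \<open>Two query rounds on a fixed number of vertices\<close>

text \<open>No answer precedes round one, so its queries form a fixed set \<open>Q\<close>;
  \<open>q2\<close> sends the positive answers of round one to the queries of round two.\<close>

locale two_rounds =
  fixes n :: nat and \<delta> :: real
    and Q :: "nat set set" and q2 :: "nat set set \<Rightarrow> nat set set"
  assumes n_ge_2: "2 \<le> n" and \<delta>_ge_1: "1 \<le> \<delta>" and \<delta>_less_2: "\<delta> < 2"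
    and Q_sub: "Q \<subseteq> vertex_pairs n" and card_Q: "real (card Q) \<le> real n powr \<delta>"
    and q2_sub: "\<And>F. F \<subseteq> Q \<Longrightarrow> q2 F \<subseteq> vertex_pairs n"
    and card_q2: "\<And>F. F \<subseteq> Q \<Longrightarrow> real (card (q2 F)) \<le> real n powr \<delta>"
begin

lemma finite_Q: "finite Q"
  using Q_sub by (auto simp: vertex_pairs_eq intro: finite_subset)

lemma card_edge_Q: "\<forall>e\<in>Q. card e = 2"
  using Q_sub by (auto simp: vertex_pairs_def)

text \<open>One event for all three first-moment bounds: \<open>t = 0\<close> for cliques of heavy
  vertices, \<open>\<W> = {{}}\<close> for cliques without first-round pairs, and
  \<open>\<W>\<close> a family of \<open>covers\<close> for the full decomposition.\<close>

definition hit :: "nat set set \<Rightarrow> nat \<Rightarrow> nat \<Rightarrow> nat set set set" where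
  "hit \<W> t d = {E. E \<subseteq> vertex_pairs n \<and>
     (\<exists>W\<in>\<W>. \<exists>T. second_round_extension Q q2 {..<n} t d (E \<inter> Q) W T \<and> pairs_in (W \<union> T) \<subseteq> E)}"

lemma card_second_round_cliques_le:
  assumes "F \<subseteq> Q"
  shows "real (card {T. T \<subseteq> {..<n} \<and> card T = t \<and> pairs_in T \<subseteq> q2 F}) \<le> real n powr (\<delta> * t / 2 + 1)"
proof -
  have "finite (q2 F)"
    using q2_sub[OF assms] by (auto simp: vertex_pairs_eq intro: finite_subset)
  then have "card {T. T \<subseteq> {..<n} \<and> card T = t \<and> pairs_in T \<subseteq> q2 F} \<le> n * card (q2 F) ^ (t div 2)"
    using card_cliques_le[of "{..<n}" "q2 F" t] n_ge_2 by (auto simp: lessThan_empty_iff)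
  then have "real (card {T. T \<subseteq> {..<n} \<and> card T = t \<and> pairs_in T \<subseteq> q2 F})
      \<le> real n * real (card (q2 F)) ^ (t div 2)"
    by (simp flip: of_nat_mult of_nat_power)
  also have "\<dots> \<le> real n * (real n powr \<delta>) ^ (t div 2)"
    using card_q2[OF assms] by (intro mult_left_mono power_mono) auto
  also have "\<dots> = real n powr (\<delta> * real (t div 2) + 1)"
    using n_ge_2 by (simp add: powr_add powr_powr flip: powr_realpow)
  also have "\<dots> \<le> real n powr (\<delta> * t / 2 + 1)"
  proof (rule powr_mono)
    have "real (t div 2) \<le> t / 2"
      by linarith
    then show "\<delta> * real (t div 2) + 1 \<le> \<delta> * t / 2 + 1"
      using \<delta>_ge_1 mult_left_mono[of "real (t div 2)" "t / 2" \<delta>] by simp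
  qed (use n_ge_2 in auto)
  finally show ?thesis .
qed

text \<open>First-moment bound: the number of sets \<open>W\<close>, the number of second-round
  cliques \<open>T\<close>, and the probability of all pairs, corrected by the at most
  \<open>d * t\<close> pairs that are not charged.\<close>

lemma prob_hit_le:
  assumes "finite \<W>" "\<And>W. W \<in> \<W> \<Longrightarrow> W \<subseteq> {..<n} \<and> card W = w"
  shows "measure_pmf.prob (random_graph n) (hit \<W> t d)
     \<le> real (card \<W>) * real n powr (\<delta> * t / 2 + 1) * 2 ^ (d * t) / 2 ^ ((w + t) choose 2)"
proof -
  define B where "B = nat \<lfloor>real n powr (\<delta> * t / 2 + 1)\<rfloor>"
  have B: "card {T. T \<subseteq> {..<n} \<and> card T = t \<and> pairs_in T \<subseteq> q2 F} \<le> B" if "F \<subseteq> Q" for F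
    unfolding B_def using card_second_round_cliques_le[OF that, of t] by (simp add: le_nat_floor)
  have fin: "finite (vertex_pairs n)"
    by (simp add: vertex_pairs_eq)
  have "card (hit \<W> t d) * 2 ^ ((w + t) choose 2) \<le> card \<W> * (B * 2 ^ (d * t) * 2 ^ card (vertex_pairs n))"
    unfolding hit_def vertex_pairs_eq
    by (rule card_two_round_le[OF _ _ B assms]) (use Q_sub in \<open>auto simp: vertex_pairs_eq\<close>)
  then have "real (card (hit \<W> t d)) * 2 ^ ((w + t) choose 2)
      \<le> real (card \<W>) * (real B * 2 ^ (d * t) * 2 ^ card (vertex_pairs n))"
    using of_nat_mono[where 'a = real] by fastforce
  also have "\<dots> \<le> real (card \<W>) * (real n powr (\<delta> * t / 2 + 1) * 2 ^ (d * t) * 2 ^ card (vertex_pairs n))"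
    by (intro mult_left_mono mult_right_mono) (auto simp: B_def)
  finally have *: "real (card (hit \<W> t d)) / 2 ^ card (vertex_pairs n)
      \<le> real (card \<W>) * real n powr (\<delta> * t / 2 + 1) * 2 ^ (d * t) / 2 ^ ((w + t) choose 2)"
    by (simp add: field_simps)
  have "Pow (vertex_pairs n) \<inter> hit \<W> t d = hit \<W> t d"
    by (auto simp: hit_def)
  then have "measure_pmf.prob (random_graph n) (hit \<W> t d)
      = real (card (hit \<W> t d)) / 2 ^ card (vertex_pairs n)"
    using fin by (subst random_graph_eq, subst measure_pmf_of_set) (auto simp: card_Pow)
  then show ?thesis
    using * by simp
qed

section \<open>Heavy vertices and their neighbourhoods\<close>

text \<open>The parameter is the exponent of the number of such vertices: degrees in
  \<open>Q\<close> sum to at most \<open>2 * n powr \<delta>\<close>, so at most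
  \<open>2 * n powr z\<close> vertices qualify. A larger \<open>z\<close> means a lower
  threshold.\<close>

definition heavy :: "real \<Rightarrow> nat set" where
  "heavy z = {v \<in> {..<n}. real n powr (\<delta> - z) \<le> real (degree_in Q v)}"

lemma finite_heavy [simp]: "finite (heavy z)"
  by (simp add: heavy_def)

lemma heavy_mono: "z \<le> z' \<Longrightarrow> heavy z \<subseteq> heavy z'"
proof
  fix v assume z: "z \<le> z'" and v: "v \<in> heavy z"
  have "real n powr (\<delta> - z') \<le> real n powr (\<delta> - z)"
    using z n_ge_2 by (intro powr_mono) auto
  then show "v \<in> heavy z'"
    using v by (auto simp: heavy_def)
qed

lemma card_heavy_le: "real (card (heavy z)) \<le> 2 * real n powr z"
proof -
  have "real (card (heavy z)) * real n powr (\<delta> - z) \<le> (\<Sum>v\<in>heavy z. real (degree_in Q v))"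
    using sum_bounded_below[of "heavy z" "real n powr (\<delta> - z)" "\<lambda>v. real (degree_in Q v)"]
    by (simp add: heavy_def)
  also have "\<dots> \<le> real (2 * card Q)"
    unfolding of_nat_sum[symmetric] of_nat_le_iff
    by (intro sum_degree_in_le finite_Q card_edge_Q) simp
  also have "\<dots> \<le> 2 * real n powr \<delta>"
    using card_Q by simp
  also have "real n powr \<delta> = real n powr z * real n powr (\<delta> - z)"
    by (simp flip: powr_add)
  finally have "real (card (heavy z)) * real n powr (\<delta> - z) \<le> (2 * real n powr z) * real n powr (\<delta> - z)"
    by simp
  moreover have "real n powr (\<delta> - z) > 0"
    using n_ge_2 by simp
  ultimately show ?thesis
    by (meson mult_le_cancel_right_pos)
qed

lemma card_light_neighbours_le:
  assumes "u \<notin> heavy z"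
  shows "real (card {v. {u, v} \<in> Q}) \<le> real n powr (\<delta> - z)"
proof (cases "u < n")
  case True
  then have "real (degree_in Q u) \<le> real n powr (\<delta> - z)"
    using assms by (auto simp: heavy_def)
  moreover have "real (card {v. {u, v} \<in> Q}) \<le> real (degree_in Q u)"
    using card_neighbours_le(2)[OF finite_Q] by simp
  ultimately show ?thesis
    by linarith
next
  case False
  then have "{v. {u, v} \<in> Q} = {}"
    using Q_sub by (auto simp: vertex_pairs_def)
  then show ?thesis
    by simp
qed

definition light_neighbours :: "real \<Rightarrow> nat set \<Rightarrow> nat set" where
  "light_neighbours z Y = (\<Union>u\<in>Y - heavy z. {v. {u, v} \<in> Q})"

lemma finite_light_neighbours: "finite Y \<Longrightarrow> finite (light_neighbours z Y)"
  unfolding light_neighbours_def using card_neighbours_le(1)[OF finite_Q] by auto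

lemma card_light_neighbours_of_set_le:
  assumes "finite Y"
  shows "real (card (light_neighbours z Y)) \<le> real (card Y) * real n powr (\<delta> - z)"
proof -
  have "card (light_neighbours z Y) \<le> (\<Sum>u\<in>Y - heavy z. card {v. {u, v} \<in> Q})"
    unfolding light_neighbours_def using assms by (intro card_UN_le) auto
  then have "real (card (light_neighbours z Y)) \<le> (\<Sum>u\<in>Y - heavy z. real (card {v. {u, v} \<in> Q}))"
    by (simp flip: of_nat_sum)
  also have "\<dots> \<le> real (card (Y - heavy z)) * real n powr (\<delta> - z)"
    by (rule sum_bounded_above) (auto intro: card_light_neighbours_le)
  also have "\<dots> \<le> real (card Y) * real n powr (\<delta> - z)"
    using assms by (intro mult_right_mono) (auto intro: card_mono)
  finally show ?thesis .
qed

text \<open>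
  The parameters \<open>z\<close> and \<open>z'\<close> are consecutive points of the grid on which the crossing point is searched: heaviness is
  measured at \<open>z\<close>, but the vertices of \<open>R\<close> hang off vertices that are not even heavy at the preceding point \<open>z'\<close>.
\<close>
definition covers :: "real \<Rightarrow> real \<Rightarrow> nat \<Rightarrow> nat \<Rightarrow> nat \<Rightarrow> nat \<Rightarrow> nat set set" where
  "covers z z' l a p r = {W. W \<subseteq> {..<n} \<and> card W = l + a + 2 * p + r \<and>
     (\<exists>L A X R. W = L \<union> A \<union> X \<union> R \<and> L \<subseteq> heavy z \<and> card L = l \<and> A \<subseteq> heavy (\<delta>/2) \<and> card A = a \<and>
        X \<in> matched_sets Q p \<and> R \<subseteq> light_neighbours z' (L \<union> A \<union> X) \<and> card R = r)}"

lemma finite_covers: "finite (covers z z' l a p r)"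
  by (rule finite_subset[of _ "Pow {..<n}"]) (auto simp: covers_def)

text \<open>\<open>L\<close>, \<open>A\<close> and \<open>X\<close> are chosen first. They have at
  most \<open>k\<close> vertices in total, so every vertex of \<open>R\<close> comes from at most
  \<open>k * n powr (\<delta> - z')\<close> candidates.\<close>

lemma card_covers_le:
  assumes "l + a + 2 * p \<le> k"
  shows "real (card (covers z z' l a p r))
    \<le> (2 * real n powr z) ^ l * (2 * real n powr (\<delta>/2)) ^ a * (real n powr \<delta>) ^ p * (real k * real n powr (\<delta> - z')) ^ r"
proof -
  let ?SL = "{L. L \<subseteq> heavy z \<and> card L = l}"
  let ?SA = "{A. A \<subseteq> heavy (\<delta>/2) \<and> card A = a}"
  let ?I = "?SL \<times> ?SA \<times> matched_sets Q p"
  let ?RR = "\<lambda>(L, A, X). (\<lambda>R. L \<union> A \<union> X \<union> R) ` {R. R \<subseteq> light_neighbours z' (L \<union> A \<union> X) \<and> card R = r}"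
  have fin1: "finite ?SL" "finite ?SA"
    by (auto intro: finite_subset[of _ "Pow (heavy _)"])
  then have finI: "finite ?I"
    using finite_matched_sets[OF finite_Q] by blast
  have RR: "finite (?RR i) \<and> real (card (?RR i)) \<le> (real k * real n powr (\<delta> - z')) ^ r" if i: "i \<in> ?I" for i
  proof -
    obtain L A X where i_eq: "i = (L, A, X)" and LAX: "L \<in> ?SL" "A \<in> ?SA" "X \<in> matched_sets Q p"
      using i by auto
    let ?Y = "L \<union> A \<union> X"
    have X: "finite X" "card X = 2 * p"
      using card_of_matched_set[OF card_edge_Q LAX(3)] by auto
    have fin: "finite ?Y"
      using LAX X finite_subset[OF _ finite_heavy] by blast
    have "card ?Y \<le> card L + card A + card X"
      by (meson add_le_mono card_Un_le le_refl le_trans)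
    then have Y: "card ?Y \<le> k"
      using LAX X assms by auto
    let ?N = "light_neighbours z' ?Y"
    have finN: "finite ?N"
      by (rule finite_light_neighbours[OF fin])
    then have finR: "finite {R. R \<subseteq> ?N \<and> card R = r}"
      by (auto intro: finite_subset[of _ "Pow ?N"])
    have "card (?RR i) \<le> card {R. R \<subseteq> ?N \<and> card R = r}"
      unfolding i_eq using card_image_le[OF finR] by simp
    also have "\<dots> \<le> card ?N ^ r"
      by (rule card_subsets_le_power[OF finN])
    finally have "real (card (?RR i)) \<le> real (card ?N) ^ r"
      by (simp flip: of_nat_power)
    also have "\<dots> \<le> (real k * real n powr (\<delta> - z')) ^ r"
    proof (rule power_mono)
      have "real (card ?N) \<le> real (card ?Y) * real n powr (\<delta> - z')"
        by (rule card_light_neighbours_of_set_le[OF fin])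
      also have "\<dots> \<le> real k * real n powr (\<delta> - z')"
        using Y by (intro mult_right_mono) auto
      finally show "real (card ?N) \<le> real k * real n powr (\<delta> - z')" .
    qed simp
    finally show ?thesis
      using finR by (auto simp: i_eq)
  qed
  have sub: "covers z z' l a p r \<subseteq> (\<Union>i\<in>?I. ?RR i)"
  proof
    fix W assume "W \<in> covers z z' l a p r"
    then obtain L A X R where *: "W = L \<union> A \<union> X \<union> R" "L \<subseteq> heavy z" "card L = l" "A \<subseteq> heavy (\<delta>/2)" "card A = a"
        "X \<in> matched_sets Q p" "R \<subseteq> light_neighbours z' (L \<union> A \<union> X)" "card R = r"
      by (auto simp: covers_def)
    show "W \<in> (\<Union>i\<in>?I. ?RR i)"
      by (rule UN_I[of "(L, A, X)"]) (use * in auto)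
  qed
  have "card (covers z z' l a p r) \<le> card (\<Union>i\<in>?I. ?RR i)"
    using finI RR by (intro card_mono sub finite_UN_I) auto
  also have "\<dots> \<le> (\<Sum>i\<in>?I. card (?RR i))"
    by (rule card_UN_le[OF finI])
  finally have "real (card (covers z z' l a p r)) \<le> (\<Sum>i\<in>?I. real (card (?RR i)))"
    by (simp only: of_nat_le_iff flip: of_nat_sum)
  also have "\<dots> \<le> real (card ?I) * (real k * real n powr (\<delta> - z')) ^ r"
    by (rule sum_bounded_above) (use RR in blast)
  also have "real (card ?I) = real (card ?SL) * real (card ?SA) * real (card (matched_sets Q p))"
    by (simp add: card_cartesian_product)
  also have "\<dots> * (real k * real n powr (\<delta> - z')) ^ r \<le>
      (2 * real n powr z) ^ l * (2 * real n powr (\<delta>/2)) ^ a * (real n powr \<delta>) ^ p * (real k * real n powr (\<delta> - z')) ^ r"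
  proof (intro mult_right_mono mult_mono)
    have "real (card {S. S \<subseteq> heavy x \<and> card S = j}) \<le> (2 * real n powr x) ^ j" for x j
    proof -
      have "real (card {S. S \<subseteq> heavy x \<and> card S = j}) \<le> real (card (heavy x)) ^ j"
        using card_subsets_le_power[of "heavy x" j] by (simp flip: of_nat_power)
      also have "\<dots> \<le> (2 * real n powr x) ^ j"
        by (intro power_mono card_heavy_le) simp
      finally show ?thesis .
    qed
    then show "real (card ?SL) \<le> (2 * real n powr z) ^ l" "real (card ?SA) \<le> (2 * real n powr (\<delta>/2)) ^ a"
      by blast+
    have "real (card (matched_sets Q p)) \<le> real (card Q) ^ p"
      using card_matched_sets_le[OF finite_Q, of p] by (simp flip: of_nat_power)
    also have "\<dots> \<le> (real n powr \<delta>) ^ p"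
      by (intro power_mono card_Q) simp
    finally show "real (card (matched_sets Q p)) \<le> (real n powr \<delta>) ^ p" .
  qed auto
  finally show ?thesis .
qed

section \<open>From a found clique to a counted configuration\<close>

text \<open>A pair that is revealed but not in \<open>Q\<close> was queried in round two, so the
  configuration with empty \<open>W\<close> applies.\<close>

lemma independent_clique_hit:
  assumes "E \<subseteq> vertex_pairs n" "C \<subseteq> {..<n}" "pairs_in C \<subseteq> (Q \<union> q2 (E \<inter> Q)) \<inter> E"
    and "T \<subseteq> C" "pairs_in T \<inter> Q = {}" "\<tau> \<le> card T"
  shows "E \<in> hit {{}} \<tau> 0"
proof -
  obtain S where S: "S \<subseteq> T" "card S = \<tau>"
    using obtain_subset_with_card_n[OF assms(6)] by metis
  then have "pairs_in S \<subseteq> pairs_in T" "pairs_in S \<subseteq> pairs_in C"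
    using assms(4) by (auto intro!: pairs_in_mono)
  then have "pairs_in S \<inter> Q = {}" "pairs_in S \<subseteq> q2 (E \<inter> Q)" "pairs_in ({} \<union> S) \<subseteq> E"
    using assms(3,5) by auto
  moreover from this have "second_round_extension Q q2 {..<n} \<tau> 0 (E \<inter> Q) {} S"
    using assms(2,4) S by (auto simp: second_round_extension_def)
  ultimately show ?thesis
    using assms(1) by (auto simp: hit_def)
qed

lemma heavy_clique_hit:
  assumes "E \<subseteq> vertex_pairs n" "C \<subseteq> {..<n}" "pairs_in C \<subseteq> E" "\<mu> \<le> card (C \<inter> heavy z)"
  shows "E \<in> hit {U. U \<subseteq> heavy z \<and> card U = \<mu>} 0 0"
proof -
  obtain U where U: "U \<subseteq> C \<inter> heavy z" "card U = \<mu>"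
    using obtain_subset_with_card_n[OF assms(4)] by metis
  then have "pairs_in U \<subseteq> E"
    using assms(3) pairs_in_mono[of U C] by auto
  moreover have "second_round_extension Q q2 {..<n} 0 0 (E \<inter> Q) U {}"
    by (auto simp: second_round_extension_def pairs_in_def)
  ultimately show ?thesis
    using U assms(1) unfolding hit_def
    by (intro CollectI conjI bexI[of _ U] exI[of _ "{}"]) auto
qed

lemma clique_decomposition:
  assumes E: "E \<subseteq> vertex_pairs n" and C: "C \<subseteq> {..<n}"
    and clique: "pairs_in C \<subseteq> (Q \<union> q2 (E \<inter> Q)) \<inter> E"
    and z: "z \<le> \<delta>/2" and d: "card (C \<inter> heavy z') \<le> d"
  obtains a p r t T0 where "card C = card (C \<inter> heavy z) + a + 2 * p + r + t"
    "T0 \<subseteq> C" "pairs_in T0 \<inter> Q = {}" "card T0 = r + t"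
    "E \<in> hit (covers z z' (card (C \<inter> heavy z)) a p r) t d"
proof -
  have finC: "finite C"
    using C finite_subset by blast
  define L where "L = C \<inter> heavy z"
  define A where "A = C \<inter> heavy (\<delta>/2) - heavy z"
  define Y where "Y = C - heavy (\<delta>/2)"
  have "finite Y"
    using finC by (simp add: Y_def)
  then obtain p X where X: "X \<in> matched_sets Q p" "X \<subseteq> Y" "pairs_in (Y - X) \<inter> Q = {}"
    using exists_maximal_matched_set[OF _ card_edge_Q, of Y] by blast
  define T0 where "T0 = Y - X"
  \<comment> \<open>Vertices of \<open>T\<close> see only vertices heavy at \<open>z'\<close> within
    \<open>C\<close>, which gives the bound \<open>d\<close>. Every vertex of \<open>R\<close> has a
    neighbour in \<open>C\<close> that is not heavy at \<open>z'\<close>.\<close>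
  define T where "T = {v \<in> T0. \<forall>u\<in>C. {u, v} \<in> Q \<longrightarrow> u \<in> heavy z'}"
  define R where "R = T0 - T"
  define W where "W = L \<union> A \<union> X \<union> R"
  have hz: "heavy z \<subseteq> heavy (\<delta>/2)"
    by (rule heavy_mono[OF z])
  have fin: "finite L" "finite A" "finite X" "finite R" "finite T"
    using finC X(2) by (auto simp: L_def A_def R_def T_def T0_def Y_def intro: finite_subset)
  have disj: "L \<inter> A = {}" "(L \<union> A) \<inter> X = {}" "(L \<union> A \<union> X) \<inter> R = {}" "W \<inter> T = {}"
    using X(2) hz by (auto simp: W_def L_def A_def R_def T_def T0_def Y_def)
  have C_eq: "C = W \<union> T"
    using X(2) hz by (auto simp: W_def L_def A_def R_def T_def T0_def Y_def)
  have WTC: "W \<subseteq> C" "T \<subseteq> C"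
    using C_eq by blast+
  have card_X: "card X = 2 * p"
    using card_of_matched_set[OF card_edge_Q X(1)] by auto
  have card_W: "card W = card L + card A + 2 * p + card R"
    unfolding W_def using fin disj card_X by (simp add: card_Un_disjoint)
  have T0C: "T0 \<subseteq> C"
    by (auto simp: T0_def Y_def)
  have T0: "pairs_in T0 \<inter> Q = {}"
    using X(3) by (simp add: T0_def)
  have "R \<subseteq> light_neighbours z' (L \<union> A \<union> X)"
  proof
    fix v assume v: "v \<in> R"
    then obtain u where u: "u \<in> C" "{u, v} \<in> Q" "u \<notin> heavy z'"
      by (auto simp: R_def T_def)
    \<comment> \<open>Independence of \<open>T0\<close> forces the neighbour \<open>u\<close> into
      \<open>L \<union> A \<union> X\<close>, so \<open>R\<close> hangs off vertices that are
      already chosen.\<close>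
    have "u \<notin> T0"
    proof
      assume "u \<in> T0"
      moreover have "u \<noteq> v"
        using u(2) card_edge_Q by fastforce
      ultimately have "{u, v} \<in> pairs_in T0"
        using v by (intro doubleton_in_pairs_in) (auto simp: R_def)
      then show False
        using u(2) T0 by auto
    qed
    then have "u \<in> L \<union> A \<union> X"
      using u(1) by (auto simp: L_def A_def T0_def Y_def)
    then show "v \<in> light_neighbours z' (L \<union> A \<union> X)"
      using u by (auto simp: light_neighbours_def)
  qed
  moreover have "L \<subseteq> heavy z" "A \<subseteq> heavy (\<delta>/2)" "W \<subseteq> {..<n}"
    using C WTC(1) by (auto simp: L_def A_def)
  ultimately have "W \<in> covers z z' (card L) (card A) p (card R)"
    unfolding covers_def using X(1) card_W W_def by blast
  moreover have "second_round_extension Q q2 {..<n} (card T) d (E \<inter> Q) W T"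
    unfolding second_round_extension_def
  proof (intro conjI ballI)
    have "pairs_in T \<subseteq> pairs_in T0"
      by (intro pairs_in_mono) (auto simp: T_def)
    then show TQ: "pairs_in T \<inter> Q = {}"
      using T0 by auto
    have "pairs_in T \<subseteq> pairs_in C"
      using WTC(2) by (rule pairs_in_mono)
    then show "pairs_in T \<subseteq> q2 (E \<inter> Q)"
      using clique TQ by auto
    fix v assume v: "v \<in> T"
    have "{u \<in> W. {u, v} \<in> Q} \<subseteq> C \<inter> heavy z'"
      using v WTC(1) unfolding T_def by blast
    then have "card {u \<in> W. {u, v} \<in> Q} \<le> card (C \<inter> heavy z')"
      using finC by (intro card_mono) auto
    then show "card {u \<in> W. {u, v} \<in> Q} \<le> d"
      using d by linarith
  qed (use C WTC disj in auto)
  moreover have "pairs_in (W \<union> T) \<subseteq> E"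
    using clique unfolding C_eq[symmetric] by blast
  ultimately have "E \<in> hit (covers z z' (card L) (card A) p (card R)) (card T) d"
    using E unfolding hit_def by blast
  moreover have "card C = card L + card A + 2 * p + card R + card T"
    using card_Un_disjoint[of W T] card_W finite_subset[OF WTC(1) finC] fin(5) disj(4) C_eq by simp
  moreover have "card T0 = card R + card T"
  proof -
    have "T0 = R \<union> T" "R \<inter> T = {}"
      by (auto simp: R_def T_def)
    then show ?thesis
      using fin by (simp add: card_Un_disjoint)
  qed
  ultimately show ?thesis
    using that[of "card A" p "card R" "card T" T0] T0 T0C unfolding L_def by blast
qed

end

subsection \<open>First-moment estimates\<close>

text \<open>The left side is the base 2 logarithm of the product in
  \<open>prob_covers_hit_le\<close>. At \<gamma> = 0 the gain \<beta>(\<beta> - \<delta>)/2 equals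
  2/9 \<delta>^2, the value of the loss m(\<delta> - m) at its worst point m = \<delta>/3; hence the
  constant 4/3. A positive \<gamma> leaves a negative quadratic term.\<close>

lemma first_moment_exponent_le:
  fixes N :: real
  assumes N: "0 < N" and \<delta>: "1 \<le> \<delta>" "\<delta> < 2" and \<gamma>: "0 < \<gamma>" "4/3 * \<delta> + \<gamma> \<le> 2"
    and \<epsilon>: "\<epsilon> = \<gamma> / 8" and \<eta>: "0 < \<eta>" "\<eta> \<le> \<gamma> / 16" and m: "0 \<le> m" "m \<le> \<delta> / 2" "z = \<delta> / 2 - m"
    and nonneg: "0 \<le> l" "0 \<le> a" "0 \<le> p" "0 \<le> r" "0 \<le> t"
    and l: "m * N \<le> l" "l \<le> (2 * z + \<epsilon>) * N" and rt: "r + t \<le> (\<delta> + \<epsilon>) * N"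
    and k: "k = l + a + 2 * p + r + t" "(4/3 * \<delta> + \<gamma>) * N \<le> k" "k \<le> (4/3 * \<delta> + \<gamma>) * N + 1"
  shows "N * ((z + \<eta>) * l + (\<delta>/2 + \<eta>) * a + \<delta> * p + (\<delta> - z + 2 * \<eta>) * r + (\<delta> * t / 2 + 1) + (m + \<eta>) * t)
      - k * (k - 1) / 2 \<le> 3 * N + 1 - \<gamma> / 3 * N\<^sup>2"
proof -
  define \<beta> where "\<beta> = 4/3 * \<delta> + \<gamma>"
  have "(z + \<eta>) * l + (\<delta>/2 + \<eta>) * a + \<delta> * p + (\<delta> - z + 2 * \<eta>) * r + (\<delta> * t / 2 + 1) + (m + \<eta>) * t
      = \<delta> * k / 2 - m * l + m * (r + t) + \<eta> * (l + a + 2 * r + t) + 1"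
    unfolding k(1) m(3) by (simp add: field_simps)
  also have "\<dots> \<le> \<delta> * k / 2 - m * (m * N) + m * ((\<delta> + \<epsilon>) * N) + \<eta> * (2 * k) + 1"
  proof -
    have "m * (m * N) \<le> m * l" "m * (r + t) \<le> m * ((\<delta> + \<epsilon>) * N)"
      using m(1) l(1) rt by (auto intro: mult_left_mono)
    moreover have "\<eta> * (l + a + 2 * r + t) \<le> \<eta> * (2 * k)"
      using \<eta>(1) nonneg k(1) by (intro mult_left_mono) auto
    ultimately show ?thesis
      by linarith
  qed
  finally have main: "N * ((z + \<eta>) * l + (\<delta>/2 + \<eta>) * a + \<delta> * p + (\<delta> - z + 2 * \<eta>) * r + (\<delta> * t / 2 + 1) + (m + \<eta>) * t)
      \<le> N * (\<delta> * k / 2 - m * (m * N) + m * ((\<delta> + \<epsilon>) * N) + \<eta> * (2 * k) + 1)"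
    using N by (intro mult_left_mono) auto
  \<comment> \<open>The two bounds on \<open>l\<close> give m \<le> 2z + \<epsilon>, where 2z =
    \<delta> - 2m.\<close>
  have m3: "m \<le> (\<delta> + \<epsilon>) / 3"
  proof -
    have "m * N \<le> (2 * z + \<epsilon>) * N"
      using l by linarith
    then have "m \<le> 2 * z + \<epsilon>"
      using N by simp
    then show ?thesis
      using m(3) by (simp add: field_simps)
  qed
  have mm: "m * (\<delta> - m) \<le> 2 * \<delta>\<^sup>2 / 9 + \<epsilon>"
  proof -
    \<comment> \<open>The product m(\<delta> - m) is compared with its value at m = \<delta>/3.
      Beyond that point, \<open>m3\<close> makes the first factor at most \<epsilon>, and the second
      is below 1 since \<delta> < 2.\<close>
    have eq: "m * (\<delta> - m) = 2 * \<delta>\<^sup>2 / 9 + (m - \<delta>/3) * (2 * \<delta>/3 - m)"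
      by (simp add: power2_eq_square field_simps)
    have "(m - \<delta>/3) * (2 * \<delta>/3 - m) \<le> \<epsilon>"
    proof (cases "m \<le> \<delta>/3")
      case True
      then have "(m - \<delta>/3) * (2 * \<delta>/3 - m) \<le> 0"
        using m \<delta> by (intro mult_nonpos_nonneg) auto
      then show ?thesis
        using \<epsilon> \<gamma>(1) by linarith
    next
      case False
      then have "(m - \<delta>/3) * (2 * \<delta>/3 - m) \<le> \<epsilon> * 1"
        using m m3 \<delta> \<epsilon> \<gamma>(1) by (intro mult_mono) auto
      then show ?thesis
        by simp
    qed
    then show ?thesis
      using eq by linarith
  qed
  have "k * (k - \<delta> * N) \<ge> (\<beta> * N) * ((\<beta> - \<delta>) * N)"
  proof (rule mult_mono)
    show "\<beta> * N \<le> k" "(\<beta> - \<delta>) * N \<le> k - \<delta> * N"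
      using k(2) by (auto simp: \<beta>_def algebra_simps)
    show "0 \<le> k"
      using k(1) nonneg by simp
    show "0 \<le> (\<beta> - \<delta>) * N"
      using \<delta> \<gamma> N by (simp add: \<beta>_def)
  qed
  moreover have "\<beta> * (\<beta> - \<delta>) \<ge> 4 * \<delta>\<^sup>2 / 9 + 5 / 3 * \<gamma>"
  proof -
    have "\<beta> * (\<beta> - \<delta>) = 4 * \<delta>\<^sup>2 / 9 + 5 / 3 * (\<delta> * \<gamma>) + \<gamma>\<^sup>2"
      by (simp add: \<beta>_def power2_eq_square field_simps)
    moreover have "\<delta> * \<gamma> \<ge> 1 * \<gamma>"
      using \<delta> \<gamma> by (intro mult_right_mono) auto
    moreover have "\<gamma>\<^sup>2 \<ge> 0"
      by simp
    ultimately show ?thesis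
      by linarith
  qed
  then have "(\<beta> * (\<beta> - \<delta>)) * N\<^sup>2 \<ge> (4 * \<delta>\<^sup>2 / 9 + 5 / 3 * \<gamma>) * N\<^sup>2"
    by (intro mult_right_mono) auto
  ultimately have quad: "k * (k - \<delta> * N) \<ge> (4 * \<delta>\<^sup>2 / 9 + 5 / 3 * \<gamma>) * N\<^sup>2"
    by (simp add: power2_eq_square algebra_simps)
  have k2: "k \<le> 2 * N + 1"
  proof -
    have "(4/3 * \<delta> + \<gamma>) * N \<le> 2 * N"
      using \<gamma> N by (intro mult_right_mono) auto
    then show ?thesis
      using k(3) by linarith
  qed
  have \<eta>k: "N * (\<eta> * (2 * k)) \<le> \<gamma> / 4 * N\<^sup>2 + N"
  proof -
    have "\<eta> * k \<le> \<gamma> / 16 * (2 * N + 1)"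
      using \<eta> k2 k(1) nonneg by (intro mult_mono) auto
    also have "\<dots> \<le> \<gamma> / 8 * N + 1 / 2"
      using \<gamma> \<delta> by (simp add: algebra_simps)
    finally have "N * (\<eta> * k) \<le> N * (\<gamma> / 8 * N + 1 / 2)"
      using N by (intro mult_left_mono) auto
    then show ?thesis
      by (simp add: power2_eq_square algebra_simps)
  qed
  have lin: "N * (- m * (m * N) + m * ((\<delta> + \<epsilon>) * N)) \<le> (2 * \<delta>\<^sup>2 / 9 + 2 * \<epsilon>) * N\<^sup>2"
  proof -
    have "m * \<epsilon> \<le> 1 * \<epsilon>"
      using m \<delta> \<epsilon> \<gamma> by (intro mult_right_mono) auto
    then have "m * (\<delta> - m) + m * \<epsilon> \<le> 2 * \<delta>\<^sup>2 / 9 + 2 * \<epsilon>"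
      using mm by linarith
    then have "(m * (\<delta> - m) + m * \<epsilon>) * N\<^sup>2 \<le> (2 * \<delta>\<^sup>2 / 9 + 2 * \<epsilon>) * N\<^sup>2"
      by (intro mult_right_mono) auto
    then show ?thesis
      by (simp add: power2_eq_square algebra_simps)
  qed
  have "N * (\<delta> * k / 2 - m * (m * N) + m * ((\<delta> + \<epsilon>) * N) + \<eta> * (2 * k) + 1) - k * (k - 1) / 2
     = N * (- m * (m * N) + m * ((\<delta> + \<epsilon>) * N)) + N * (\<eta> * (2 * k)) + N + k / 2 - k * (k - \<delta> * N) / 2"
    by (simp add: field_simps)
  also have "\<dots> \<le> (2 * \<delta>\<^sup>2 / 9 + 2 * \<epsilon>) * N\<^sup>2 + (\<gamma> / 4 * N\<^sup>2 + N) + N + (2 * N + 1) / 2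
      - (4 * \<delta>\<^sup>2 / 9 + 5 / 3 * \<gamma>) * N\<^sup>2 / 2"
    using lin \<eta>k k2 quad by (intro add_mono diff_mono divide_right_mono) auto
  \<comment> \<open>The terms in \<delta>^2 cancel, and 2\<epsilon> + \<gamma>/4 - 5\<gamma>/6 =
    -\<gamma>/3.\<close>
  also have "\<dots> \<le> 3 * N + 1 - \<gamma> / 3 * N\<^sup>2"
    unfolding \<epsilon> by (simp add: field_simps)
  finally show ?thesis
    using main by linarith
qed

section \<open>Probabilities of the three kinds of configurations\<close>

context two_rounds
begin

abbreviation N :: real where "N \<equiv> log 2 (real n)"

lemma N_ge_1: "1 \<le> N"
  using n_ge_2 by (simp add: le_log_iff)

lemma n_powr: "real n powr x = 2 powr (N * x)"
  using n_ge_2 by (simp flip: powr_powr)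

lemma n_powr_power: "(real n powr x) ^ j = 2 powr (N * (x * real j))"
  by (simp add: n_powr powr_powr mult.assoc flip: powr_realpow)

lemma two_power_choose: "(2::real) ^ (k choose 2) = 2 powr (real k * (real k - 1) / 2)"
  by (simp add: real_choose_two flip: powr_realpow)

text \<open>There are at most \<open>(2 * n powr z) ^ \<mu>\<close> candidate sets, while a clique
  has probability about 2 to the power -\<mu>^2/2; the union bound wins once \<mu> exceeds 2zN by
  \<epsilon>N.\<close>

lemma prob_heavy_hit_le:
  assumes \<epsilon>: "0 < \<epsilon>" "\<epsilon> < 1/2" "3 \<le> \<epsilon> * N" and z: "0 \<le> z" and \<mu>: "(2 * z + \<epsilon>) * N \<le> real \<mu>"
  shows "measure_pmf.prob (random_graph n) (hit {U. U \<subseteq> heavy z \<and> card U = \<mu>} 0 0)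
    \<le> 2 powr (2 * N - \<epsilon>\<^sup>2 / 2 * N\<^sup>2)"
proof -
  let ?F = "{U. U \<subseteq> heavy z \<and> card U = \<mu>}"
  have "finite ?F"
    by (auto intro: finite_subset[of _ "Pow (heavy z)"])
  then have "measure_pmf.prob (random_graph n) (hit ?F 0 0)
      \<le> real (card ?F) * real n powr (\<delta> * real 0 / 2 + 1) * 2 ^ (0 * 0) / 2 ^ ((\<mu> + 0) choose 2)"
    by (rule prob_hit_le) (auto simp: heavy_def)
  also have "\<dots> = real (card ?F) * (2 powr N / 2 powr (real \<mu> * (real \<mu> - 1) / 2))"
    using n_powr[of 1] by (simp add: two_power_choose)
  also have "\<dots> \<le> (2 * real n powr z) ^ \<mu> * (2 powr N / 2 powr (real \<mu> * (real \<mu> - 1) / 2))"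
  proof (intro mult_right_mono)
    have "real (card ?F) \<le> real (card (heavy z)) ^ \<mu>"
      using card_subsets_le_power[of "heavy z" \<mu>] by (simp flip: of_nat_power)
    also have "\<dots> \<le> (2 * real n powr z) ^ \<mu>"
      by (intro power_mono card_heavy_le) simp
    finally show "real (card ?F) \<le> (2 * real n powr z) ^ \<mu>" .
  qed simp
  also have "(2 * real n powr z) ^ \<mu> = 2 powr (real \<mu> + N * (z * real \<mu>))"
    by (simp add: power_mult_distrib n_powr_power powr_add powr_realpow)
  also have "\<dots> * (2 powr N / 2 powr (real \<mu> * (real \<mu> - 1) / 2))
      = 2 powr (real \<mu> + N * (z * real \<mu>) + N - real \<mu> * (real \<mu> - 1) / 2)"
    by (simp add: powr_add powr_diff)
  also have "\<dots> \<le> 2 powr (2 * N - \<epsilon>\<^sup>2 / 2 * N\<^sup>2)"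
  proof (intro powr_mono)
    have "real \<mu> * (real \<mu> - 1) \<ge> real \<mu> * ((2 * z + \<epsilon>) * N - 1)"
      using \<mu> by (intro mult_left_mono) auto
    then have 1: "real \<mu> + N * (z * real \<mu>) - real \<mu> * (real \<mu> - 1) / 2 \<le> real \<mu> * (3/2 - \<epsilon> * N / 2)"
      by (simp add: field_simps)
    have "\<epsilon> * N \<le> real \<mu>"
      using mult_right_mono[of \<epsilon> "2 * z + \<epsilon>" N] \<mu> z N_ge_1 by linarith
    \<comment> \<open>The second factor is not positive because 3 \<le> \<epsilon>N, so a lower
      bound on \<mu> bounds the product from above.\<close>
    then have "real \<mu> * (3/2 - \<epsilon> * N / 2) \<le> (\<epsilon> * N) * (3/2 - \<epsilon> * N / 2)"
      using \<epsilon>(3) by (intro mult_right_mono_neg) auto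
    also have "\<dots> = 3/2 * (\<epsilon> * N) - \<epsilon>\<^sup>2 / 2 * N\<^sup>2"
      by (simp add: power2_eq_square field_simps)
    also have "\<dots> \<le> N - \<epsilon>\<^sup>2 / 2 * N\<^sup>2"
    proof -
      have "\<epsilon> * N \<le> 1/2 * N"
        using \<epsilon>(2) N_ge_1 by (intro mult_right_mono) auto
      then show ?thesis
        using N_ge_1 by linarith
    qed
    finally show "real \<mu> + N * (z * real \<mu>) + N - real \<mu> * (real \<mu> - 1) / 2 \<le> 2 * N - \<epsilon>\<^sup>2 / 2 * N\<^sup>2"
      using 1 by linarith
  qed simp
  finally show ?thesis .
qed

text \<open>Second-round cliques cost \<delta>/2 per vertex, so the threshold is \<delta>N by the
  same comparison as for heavy vertices.\<close>

lemma prob_independent_hit_le: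
  assumes \<epsilon>: "0 < \<epsilon>" "\<epsilon> < 1/2" "3 \<le> \<epsilon> * N" and \<tau>: "(\<delta> + \<epsilon>) * N \<le> real \<tau>"
  shows "measure_pmf.prob (random_graph n) (hit {{}} \<tau> 0) \<le> 2 powr (2 * N - \<epsilon>\<^sup>2 / 2 * N\<^sup>2)"
proof -
  have "measure_pmf.prob (random_graph n) (hit {{}} \<tau> 0)
      \<le> real (card {{} :: nat set}) * real n powr (\<delta> * real \<tau> / 2 + 1) * 2 ^ (0 * \<tau>) / 2 ^ ((0 + \<tau>) choose 2)"
    by (rule prob_hit_le) auto
  also have "\<dots> = 2 powr (N * (\<delta> * real \<tau> / 2 + 1) - real \<tau> * (real \<tau> - 1) / 2)"
    by (simp add: two_power_choose n_powr powr_diff)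
  also have "\<dots> \<le> 2 powr (2 * N - \<epsilon>\<^sup>2 / 2 * N\<^sup>2)"
  proof (intro powr_mono)
    have "real \<tau> * (real \<tau> - 1) \<ge> real \<tau> * ((\<delta> + \<epsilon>) * N - 1)"
      using \<tau> by (intro mult_left_mono) auto
    then have 1: "N * (\<delta> * real \<tau> / 2 + 1) - real \<tau> * (real \<tau> - 1) / 2 \<le> N + real \<tau> * (1 - \<epsilon> * N) / 2"
      by (simp add: field_simps)
    have "1 * N \<le> (\<delta> + \<epsilon>) * N"
      using \<delta>_ge_1 \<epsilon>(1) N_ge_1 by (intro mult_right_mono) auto
    then have "N \<le> real \<tau>"
      using \<tau> by linarith
    then have "real \<tau> * (1 - \<epsilon> * N) \<le> N * (1 - \<epsilon> * N)"
      using \<epsilon>(3) by (intro mult_right_mono_neg) auto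
    moreover have "N * (1 - \<epsilon> * N) \<le> N - \<epsilon>\<^sup>2 * N\<^sup>2"
    proof -
      have "\<epsilon> * \<epsilon> \<le> 1 * \<epsilon>"
        using \<epsilon> by (intro mult_right_mono) auto
      then have "\<epsilon>\<^sup>2 * N\<^sup>2 \<le> \<epsilon> * N\<^sup>2"
        by (intro mult_right_mono) (auto simp: power2_eq_square)
      then show ?thesis
        by (simp add: power2_eq_square algebra_simps)
    qed
    ultimately show "N * (\<delta> * real \<tau> / 2 + 1) - real \<tau> * (real \<tau> - 1) / 2 \<le> 2 * N - \<epsilon>\<^sup>2 / 2 * N\<^sup>2"
      using 1 N_ge_1 by (simp add: field_simps)
  qed simp
  finally show ?thesis .
qed

text \<open>A factor \<open>n powr \<eta>\<close> absorbs each constant 2 and the factor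
  \<open>k\<close>. A vertex of \<open>R\<close> pays \<eta> twice: once for \<open>k\<close> and
  once for the grid step from \<open>z\<close> down to \<open>z'\<close>.\<close>

lemma prob_covers_hit_le:
  assumes \<gamma>: "0 < \<gamma>" "4/3 * \<delta> + \<gamma> \<le> 2" and \<epsilon>: "\<epsilon> = \<gamma> / 8"
    and \<eta>: "0 < \<eta>" "\<eta> \<le> \<gamma> / 16" and m: "0 \<le> m" "m \<le> \<delta> / 2" "z = \<delta> / 2 - m" "z' = z - \<eta>"
    and l: "m * N \<le> real l" "real l \<le> (2 * z + \<epsilon>) * N" and rt: "real (r + t) \<le> (\<delta> + \<epsilon>) * N"
    and k: "k = l + a + 2 * p + r + t" "(4/3 * \<delta> + \<gamma>) * N \<le> real k" "real k \<le> (4/3 * \<delta> + \<gamma>) * N + 1"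
    and large: "2 \<le> real n powr \<eta>" "real k \<le> real n powr \<eta>" and d: "real d \<le> (m + \<eta>) * N"
  shows "measure_pmf.prob (random_graph n) (hit (covers z z' l a p r) t d) \<le> 2 powr (3 * N + 1 - \<gamma> / 3 * N\<^sup>2)"
proof -
  have "measure_pmf.prob (random_graph n) (hit (covers z z' l a p r) t d)
      \<le> real (card (covers z z' l a p r)) * real n powr (\<delta> * t / 2 + 1) * 2 ^ (d * t) / 2 ^ ((l + a + 2 * p + r + t) choose 2)"
    by (rule prob_hit_le[OF finite_covers]) (auto simp: covers_def)
  also have "\<dots> \<le> (real n powr (z + \<eta>)) ^ l * (real n powr (\<delta>/2 + \<eta>)) ^ a * (real n powr \<delta>) ^ p
      * (real n powr (\<delta> - z + 2 * \<eta>)) ^ r * real n powr (\<delta> * t / 2 + 1) * 2 powr (N * ((m + \<eta>) * t))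
      / 2 ^ ((l + a + 2 * p + r + t) choose 2)"
  proof (intro divide_right_mono mult_mono mult_right_mono)
    have "2 * real n powr x \<le> real n powr (x + \<eta>)" for x
      using mult_right_mono[OF large(1), of "real n powr x"] by (simp add: powr_add mult.commute)
    moreover have "real k * real n powr (\<delta> - z') \<le> real n powr (\<delta> - z + 2 * \<eta>)"
    proof -
      have "real k * real n powr (\<delta> - z') \<le> real n powr \<eta> * real n powr (\<delta> - z')"
        using large(2) by (intro mult_right_mono) auto
      also have "\<dots> = real n powr (\<eta> + (\<delta> - z'))"
        by (rule powr_add[symmetric])
      also have "\<eta> + (\<delta> - z') = \<delta> - z + 2 * \<eta>"
        using m(4) by simp
      finally show ?thesis .
    qed
    ultimately have "(2 * real n powr z) ^ l * (2 * real n powr (\<delta>/2)) ^ a * (real n powr \<delta>) ^ p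
        * (real k * real n powr (\<delta> - z')) ^ r
      \<le> (real n powr (z + \<eta>)) ^ l * (real n powr (\<delta>/2 + \<eta>)) ^ a * (real n powr \<delta>) ^ p
        * (real n powr (\<delta> - z + 2 * \<eta>)) ^ r"
      by (intro mult_mono power_mono) auto
    moreover have "real (card (covers z z' l a p r)) \<le> (2 * real n powr z) ^ l * (2 * real n powr (\<delta>/2)) ^ a
        * (real n powr \<delta>) ^ p * (real k * real n powr (\<delta> - z')) ^ r"
      by (rule card_covers_le) (simp add: k(1))
    ultimately show "real (card (covers z z' l a p r)) \<le> (real n powr (z + \<eta>)) ^ l * (real n powr (\<delta>/2 + \<eta>)) ^ a
        * (real n powr \<delta>) ^ p * (real n powr (\<delta> - z + 2 * \<eta>)) ^ r"
      by linarith
    have "(2::real) ^ (d * t) = 2 powr (real d * real t)"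
      by (simp flip: powr_realpow)
    also have "\<dots> \<le> 2 powr (N * ((m + \<eta>) * t))"
      using mult_right_mono[OF d, of "real t"] by (intro powr_mono) (auto simp: mult_ac)
    finally show "(2::real) ^ (d * t) \<le> 2 powr (N * ((m + \<eta>) * t))" .
  qed auto
  also have "\<dots> = 2 powr (N * ((z + \<eta>) * l + (\<delta>/2 + \<eta>) * a + \<delta> * p + (\<delta> - z + 2 * \<eta>) * r
      + (\<delta> * t / 2 + 1) + (m + \<eta>) * t) - real k * (real k - 1) / 2)"
    unfolding k(1)[symmetric] two_power_choose n_powr_power n_powr[of "\<delta> * t / 2 + 1"] powr_diff
    by (simp only: distrib_left powr_add)
  also have "\<dots> \<le> 2 powr (3 * N + 1 - \<gamma> / 3 * N\<^sup>2)"
    using N_ge_1 \<delta>_ge_1 \<delta>_less_2 k rt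
    by (intro powr_mono first_moment_exponent_le[OF _ _ _ \<gamma> \<epsilon> \<eta> m(1-3) _ _ _ _ _ l]) auto
  finally show ?thesis .
qed

section \<open>Crossing point and union bound\<close>

definition found_clique :: "nat \<Rightarrow> nat set set set" where
  "found_clique k = {E. E \<subseteq> vertex_pairs n \<and>
     (\<exists>C \<subseteq> {..<n}. card C = k \<and> pairs_in C \<subseteq> (Q \<union> q2 (E \<inter> Q)) \<inter> E)}"

text \<open>A discrete intermediate value argument. Outside the events on heavy and on independent
  cliques, the first grid point \<open>i * \<eta>\<close> with at least (\<delta>/2 - i\<eta>)N
  heavy vertices in the clique is the crossing point, and the clique is decomposed there.\<close>

lemma found_clique_subset:
  fixes k K :: nat and \<epsilon> \<eta> :: real
  assumes K: "\<delta> / 2 = real K * \<eta>" and \<eta>: "0 < \<eta>" and \<epsilon>: "\<epsilon> < 1/2"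
  defines "\<mu> \<equiv> \<lambda>i::nat. nat \<lceil>(2 * (real i * \<eta>) + \<epsilon>) * N\<rceil>"
    and "\<tau> \<equiv> nat \<lceil>(\<delta> + \<epsilon>) * N\<rceil>"
    and "d \<equiv> \<lambda>i::nat. nat \<lfloor>(\<delta>/2 - real i * \<eta> + \<eta>) * N\<rfloor>"
    and "J \<equiv> \<lambda>i::nat. {(l, a, p, r, t). k = l + a + 2 * p + r + t \<and> (\<delta>/2 - real i * \<eta>) * N \<le> real l \<and>
                 real l \<le> (2 * (real i * \<eta>) + \<epsilon>) * N \<and> real (r + t) \<le> (\<delta> + \<epsilon>) * N}"
  shows "found_clique k \<subseteq>
      (\<Union>i\<in>{..K}. hit {U. U \<subseteq> heavy (real i * \<eta>) \<and> card U = \<mu> i} 0 0) \<union> hit {{}} \<tau> 0 \<union>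
      (\<Union>i\<in>{1..K}. \<Union>(l, a, p, r, t)\<in>J i. hit (covers (real i * \<eta>) (real i * \<eta> - \<eta>) l a p r) t (d i))"
    (is "_ \<subseteq> ?H \<union> ?I \<union> ?W")
proof
  fix E assume "E \<in> found_clique k"
  then obtain C where E: "E \<subseteq> vertex_pairs n" and C: "C \<subseteq> {..<n}" "card C = k"
      and clique: "pairs_in C \<subseteq> (Q \<union> q2 (E \<inter> Q)) \<inter> E"
    by (auto simp: found_clique_def)
  show "E \<in> ?H \<union> ?I \<union> ?W"
  proof (cases "E \<in> ?H \<union> ?I")
    case False
    define h where "h i = card (C \<inter> heavy (real i * \<eta>))" for i :: nat
    have h_le: "real (h i) \<le> (2 * (real i * \<eta>) + \<epsilon>) * N" if "i \<le> K" for i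
    proof (rule ccontr)
      assume "\<not> ?thesis"
      then have "\<mu> i \<le> h i"
        by (simp add: \<mu>_def ceiling_le_iff)
      then have "E \<in> hit {U. U \<subseteq> heavy (real i * \<eta>) \<and> card U = \<mu> i} 0 0"
        using clique unfolding h_def by (intro heavy_clique_hit[OF E C(1)]) auto
      then show False
        using False that by blast
    qed
    define P where "P i \<longleftrightarrow> (\<delta>/2 - real i * \<eta>) * N \<le> real (h i)" for i :: nat
    \<comment> \<open>The last grid point is \<delta>/2, where the threshold is 0.\<close>
    have PK: "P K"
      using K by (simp add: P_def)
    define i where "i = (LEAST i. P i)"
    have Pi: "P i" and iK: "i \<le> K"
      unfolding i_def using PK by (auto intro: LeastI Least_le)
    \<comment> \<open>At \<open>i = 0\<close> the clique has at most \<epsilon>N heavy vertices, and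
      \<epsilon> < 1/2 \<le> \<delta>/2. Hence the crossing point has a predecessor, and minimality
      bounds the heavy vertices there by \<open>d i\<close>.\<close>
    have "\<not> P 0"
    proof
      assume "P 0"
      then have "\<delta>/2 * N \<le> \<epsilon> * N"
        using h_le[of 0] by (simp add: P_def)
      moreover have "\<epsilon> * N < 1/2 * N" "1 * N \<le> \<delta> * N"
        using \<epsilon> N_ge_1 \<delta>_ge_1 by (auto intro: mult_right_mono)
      ultimately show False
        by linarith
    qed
    then have i_pos: "1 \<le> i"
      using Pi by (cases i) auto
    have "\<not> P (i - 1)"
      using i_pos not_less_Least[of "i - 1" P] by (simp add: i_def)
    then have "real (h (i - 1)) \<le> (\<delta>/2 - real (i - 1) * \<eta>) * N"
      by (simp add: P_def)
    also have "real (i - 1) * \<eta> = real i * \<eta> - \<eta>"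
      using i_pos by (simp add: of_nat_diff algebra_simps)
    finally have "real (h (i - 1)) \<le> (\<delta>/2 - real i * \<eta> + \<eta>) * N"
      by (simp add: algebra_simps)
    then have "h (i - 1) \<le> d i"
      unfolding d_def by (rule le_nat_floor)
    moreover have "h (i - 1) = card (C \<inter> heavy (real i * \<eta> - \<eta>))"
      using i_pos by (simp add: h_def of_nat_diff algebra_simps)
    ultimately have d: "card (C \<inter> heavy (real i * \<eta> - \<eta>)) \<le> d i"
      by simp
    have "real i * \<eta> \<le> \<delta> / 2"
      unfolding K using iK \<eta> by (intro mult_right_mono) auto
    then obtain a p r t T0 where dec: "card C = h i + a + 2 * p + r + t" "T0 \<subseteq> C" "pairs_in T0 \<inter> Q = {}"
        "card T0 = r + t" "E \<in> hit (covers (real i * \<eta>) (real i * \<eta> - \<eta>) (h i) a p r) t (d i)"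
      using clique_decomposition[OF E C(1) clique _ d] unfolding h_def by metis
    have "real (r + t) \<le> (\<delta> + \<epsilon>) * N"
    proof (rule ccontr)
      assume "\<not> ?thesis"
      then have "\<tau> \<le> r + t"
        by (simp add: \<tau>_def ceiling_le_iff)
      then have "E \<in> ?I"
        using independent_clique_hit[OF E C(1) clique dec(2,3)] dec(4) by simp
      then show False
        using False by blast
    qed
    then have "(h i, a, p, r, t) \<in> J i"
      using dec(1) C(2) Pi h_le[OF iK] by (simp add: J_def P_def)
    then have "E \<in> (\<Union>(l, a, p, r, t)\<in>J i. hit (covers (real i * \<eta>) (real i * \<eta> - \<eta>) l a p r) t (d i))"
      using dec(5) by (intro UN_I[of "(h i, a, p, r, t)"]) auto
    then show ?thesis
      using i_pos iK by (intro UnI2 UN_I[of i]) auto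
  qed blast
qed

text \<open>Union bound over \<open>K + 1\<close> heavy events, one independent event, and, for each
  of \<open>K\<close> crossing points, at most \<open>(k + 1) ^ 5\<close> tuples
  \<open>(l, a, p, r, t)\<close>.\<close>

lemma prob_found_clique_le:
  fixes k K :: nat and \<gamma> \<eta> :: real
  assumes \<gamma>: "0 < \<gamma>" "4/3 * \<delta> + \<gamma> \<le> 2"
    and K: "\<delta> / 2 = real K * \<eta>" and \<eta>: "0 < \<eta>" "\<eta> \<le> \<gamma> / 16"
    and k: "(4/3 * \<delta> + \<gamma>) * N \<le> real k" "real k \<le> (4/3 * \<delta> + \<gamma>) * N + 1"
    and large: "24 \<le> \<gamma> * N" "2 \<le> real n powr \<eta>" "real k \<le> real n powr \<eta>"
  shows "measure_pmf.prob (random_graph n) (found_clique k)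
    \<le> (real K + 2) * 2 powr (2 * N - (\<gamma>/8)\<^sup>2 / 2 * N\<^sup>2)
       + real K * (2 * N + 2) ^ 5 * 2 powr (3 * N + 1 - \<gamma> / 3 * N\<^sup>2)"
proof -
  define \<epsilon> where "\<epsilon> = \<gamma> / 8"
  have \<epsilon>: "0 < \<epsilon>" "\<epsilon> < 1/2" "3 \<le> \<epsilon> * N"
    using \<gamma> \<delta>_ge_1 large(1) by (auto simp: \<epsilon>_def)
  let ?z = "\<lambda>i::nat. real i * \<eta>"
  let ?\<mu> = "\<lambda>i::nat. nat \<lceil>(2 * ?z i + \<epsilon>) * N\<rceil>"
  let ?\<tau> = "nat \<lceil>(\<delta> + \<epsilon>) * N\<rceil>"
  let ?d = "\<lambda>i::nat. nat \<lfloor>(\<delta>/2 - ?z i + \<eta>) * N\<rfloor>"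
  define J where "J = (\<lambda>i::nat. {(l, a, p, r, t). k = l + a + 2 * p + r + t \<and> (\<delta>/2 - ?z i) * N \<le> real l \<and>
                 real l \<le> (2 * ?z i + \<epsilon>) * N \<and> real (r + t) \<le> (\<delta> + \<epsilon>) * N})"
  let ?pr = "measure_pmf.prob (random_graph n)"
  let ?H = "\<lambda>i. hit {U. U \<subseteq> heavy (?z i) \<and> card U = ?\<mu> i} 0 0"
  let ?I = "hit {{}} ?\<tau> 0"
  let ?W = "\<lambda>i (l, a, p, r, t). hit (covers (?z i) (?z i - \<eta>) l a p r) t (?d i)"
  let ?A = "2 powr (2 * N - \<epsilon>\<^sup>2 / 2 * N\<^sup>2)" and ?B = "2 powr (3 * N + 1 - \<gamma> / 3 * N\<^sup>2)"
  have sub: "found_clique k \<subseteq> (\<Union>i\<in>{..K}. ?H i) \<union> ?I \<union> (\<Union>i\<in>{1..K}. \<Union>j\<in>J i. ?W i j)"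
    unfolding J_def by (rule found_clique_subset[OF K \<eta>(1) \<epsilon>(2)])
  have J_sub: "J i \<subseteq> {..k} \<times> {..k} \<times> {..k} \<times> {..k} \<times> {..k}" for i
    by (auto simp: J_def)
  then have finJ: "finite (J i)" for i
    by (rule finite_subset) auto
  have cardJ: "real (card (J i)) \<le> (2 * N + 2) ^ 5" for i
  proof -
    have "card (J i) \<le> card ({..k} \<times> {..k} \<times> {..k} \<times> {..k} \<times> {..k})"
      by (intro card_mono J_sub) auto
    also have "\<dots> = (k + 1) ^ 5"
      by (simp add: card_cartesian_product power_def numeral_eq_Suc)
    finally have "real (card (J i)) \<le> real (k + 1) ^ 5"
      by (simp only: of_nat_le_iff flip: of_nat_power)
    also have "\<dots> \<le> (2 * N + 2) ^ 5"
    proof (rule power_mono)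
      have "(4/3 * \<delta> + \<gamma>) * N \<le> 2 * N"
        using \<gamma> N_ge_1 by (intro mult_right_mono) auto
      then show "real (k + 1) \<le> 2 * N + 2"
        using k(2) by simp
    qed simp
    finally show ?thesis .
  qed
  have "?pr (found_clique k) \<le> ?pr ((\<Union>i\<in>{..K}. ?H i) \<union> ?I \<union> (\<Union>i\<in>{1..K}. \<Union>j\<in>J i. ?W i j))"
    by (rule measure_pmf.finite_measure_mono[OF sub]) simp
  also have "\<dots> \<le> ?pr (\<Union>i\<in>{..K}. ?H i) + ?pr ?I + ?pr (\<Union>i\<in>{1..K}. \<Union>j\<in>J i. ?W i j)"
    by (intro order.trans[OF measure_Un_le] add_mono) auto
  also have "?pr (\<Union>i\<in>{..K}. ?H i) \<le> (real K + 1) * ?A"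
  proof -
    have "?pr (\<Union>i\<in>{..K}. ?H i) \<le> (\<Sum>i\<in>{..K}. ?pr (?H i))"
      by (rule measure_UNION_le) auto
    also have "\<dots> \<le> real (card {..K}) * ?A"
    proof (rule sum_bounded_above)
      fix i assume "i \<in> {..K}"
      show "?pr (?H i) \<le> ?A"
        using \<eta>(1) by (intro prob_heavy_hit_le[OF \<epsilon>] real_nat_ceiling_ge) auto
    qed
    finally show ?thesis
      by (simp add: add.commute)
  qed
  also have "?pr ?I \<le> ?A"
    by (rule prob_independent_hit_le[OF \<epsilon> real_nat_ceiling_ge])
  also have "?pr (\<Union>i\<in>{1..K}. \<Union>j\<in>J i. ?W i j) \<le> real K * (2 * N + 2) ^ 5 * ?B"
  proof -
    have "?pr (\<Union>i\<in>{1..K}. \<Union>j\<in>J i. ?W i j) \<le> (\<Sum>i\<in>{1..K}. ?pr (\<Union>j\<in>J i. ?W i j))"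
      by (rule measure_UNION_le) auto
    also have "\<dots> \<le> real (card {1..K}) * ((2 * N + 2) ^ 5 * ?B)"
    proof (rule sum_bounded_above)
      fix i assume i: "i \<in> {1..K}"
      have z: "?z i \<le> \<delta> / 2"
        unfolding K using i \<eta> by (intro mult_right_mono) auto
      have "?pr (\<Union>j\<in>J i. ?W i j) \<le> (\<Sum>j\<in>J i. ?pr (?W i j))"
        by (rule measure_UNION_le) (auto simp: finJ)
      also have "\<dots> \<le> real (card (J i)) * ?B"
      proof (rule sum_bounded_above)
        fix j assume j: "j \<in> J i"
        obtain l a p r t where j_eq: "j = (l, a, p, r, t)"
          by (metis prod_cases5)
        have J: "k = l + a + 2 * p + r + t" "(\<delta>/2 - ?z i) * N \<le> real l"
            "real l \<le> (2 * ?z i + \<epsilon>) * N" "real (r + t) \<le> (\<delta> + \<epsilon>) * N"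
          using j by (auto simp: J_def j_eq)
        have d_le: "real (?d i) \<le> (\<delta>/2 - ?z i + \<eta>) * N"
        proof (rule of_nat_floor)
          show "0 \<le> (\<delta>/2 - ?z i + \<eta>) * N"
            using z \<eta>(1) N_ge_1 by simp
        qed
        have "?pr (hit (covers (?z i) (?z i - \<eta>) l a p r) t (?d i)) \<le> ?B"
          by (rule prob_covers_hit_le[OF \<gamma> \<epsilon>_def \<eta> _ _ _ _ J(2-4,1) k large(2,3) d_le])
             (use z \<eta>(1) in auto)
        then show "?pr (?W i j) \<le> ?B"
          by (simp add: j_eq)
      qed
      also have "\<dots> \<le> (2 * N + 2) ^ 5 * ?B"
        by (intro mult_right_mono cardJ) simp
      finally show "?pr (\<Union>j\<in>J i. ?W i j) \<le> (2 * N + 2) ^ 5 * ?B" .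
    qed
    finally show ?thesis
      by (simp add: mult.assoc)
  qed
  finally show ?thesis
    by (simp add: \<epsilon>_def algebra_simps)
qed

end

section \<open>Passage to the limit and conclusion\<close>

lemma first_moment_bound_tendsto_0:
  fixes c \<gamma> K :: real
  assumes "0 < c" "0 < \<gamma>"
  shows "((\<lambda>x. (K + 2) * 2 powr (2 * x - c * x\<^sup>2)
       + K * (2 * x + 2) ^ 5 * 2 powr (3 * x + 1 - \<gamma> / 3 * x\<^sup>2)) \<longlongrightarrow> 0) at_top"
proof -
  have *: "((\<lambda>x. 2 powr (2 * x - b * x\<^sup>2)) \<longlongrightarrow> 0) at_top"
    "((\<lambda>x. (2 * x + 2) ^ 5 * 2 powr (3 * x + 1 - b * x\<^sup>2)) \<longlongrightarrow> 0) at_top" if "0 < b" for b :: real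
    using that by real_asymp+
  have "((\<lambda>x. (K + 2) * 2 powr (2 * x - c * x\<^sup>2)
       + K * ((2 * x + 2) ^ 5 * 2 powr (3 * x + 1 - \<gamma> / 3 * x\<^sup>2))) \<longlongrightarrow> (K + 2) * 0 + K * 0) at_top"
    using assms by (intro tendsto_intros *) auto
  then show ?thesis
    by (simp add: mult.assoc)
qed

text \<open>The query bounds are known for runs on graphs. Each set \<open>F\<close> of first-round
  queries is itself a graph, and on it round one is answered by exactly \<open>F\<close>, so the
  bounds cover every argument of \<open>q2\<close>.\<close>

lemma clique_algorithm_two_rounds:
  assumes alg: "clique_algorithm (replicate 2 \<delta>) 2 \<alpha> A" and "1 \<le> \<delta>" "\<delta> < 2" "2 \<le> n"
  shows "two_rounds n \<delta> (A n []) (\<lambda>F. A n [(A n [], F)])"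
proof -
  have q: "queries (A n) E i \<subseteq> vertex_pairs n \<and> real (card (queries (A n) E i)) \<le> real n powr \<delta>"
    if "E \<subseteq> vertex_pairs n" "i < 2" for E i
    using alg that unfolding clique_algorithm_def by (metis nth_replicate)
  have q0: "queries (A n) E 0 = A n []" for E
    by (simp add: queries_def)
  have q1: "queries (A n) F 1 = A n [(A n [], F)]" if "F \<subseteq> A n []" for F
    using that by (simp add: queries_def Int_absorb1)
  have Q: "A n [] \<subseteq> vertex_pairs n" "real (card (A n [])) \<le> real n powr \<delta>"
    using q[of "{}" 0] q0 by auto
  show ?thesis
  proof
    fix F assume F: "F \<subseteq> A n []"
    then show "A n [(A n [], F)] \<subseteq> vertex_pairs n" "real (card (A n [(A n [], F)])) \<le> real n powr \<delta>"
      using q[of F 1] q1 Q(1) by auto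
  qed (use assms Q in auto)
qed

lemma revealed_graph_2:
  "revealed_graph A E 2 = (A [] \<union> A [(A [], E \<inter> A [])]) \<inter> E"
proof -
  have "{..<2::nat} = {0, 1}"
    by auto
  then show ?thesis
    by (auto simp: revealed_graph_def queries_def Int_commute)
qed

lemma clique_algorithm_le:
  assumes alg: "clique_algorithm (replicate 2 \<delta>) 2 \<alpha> A" and \<delta>: "1 \<le> \<delta>" "\<delta> < 2"
  shows "\<alpha> \<le> 4 / 3 * \<delta>"
proof (rule ccontr)
  assume less: "\<not> \<alpha> \<le> 4 / 3 * \<delta>"
  \<comment> \<open>Half of the gap above 4\<delta>/3; the other half absorbs the error term
    \<open>h\<close>.\<close>
  define \<gamma> where "\<gamma> = (\<alpha> - 4/3 * \<delta>) / 2"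
  have \<alpha>2: "\<alpha> \<le> 2"
    using alg by (simp add: clique_algorithm_def)
  have \<gamma>: "0 < \<gamma>" "4/3 * \<delta> + \<gamma> \<le> 2"
    using less \<alpha>2 by (auto simp: \<gamma>_def field_simps)
  \<comment> \<open>Enough grid points for the step \<eta> = \<delta>/(2K) to be at most
    \<gamma>/16, with \<delta>/2 itself on the grid.\<close>
  define K where "K = nat \<lceil>8 * \<delta> / \<gamma>\<rceil>"
  have K_ge: "8 * \<delta> / \<gamma> \<le> real K"
    unfolding K_def by (rule real_nat_ceiling_ge)
  moreover have "0 < 8 * \<delta> / \<gamma>"
    using \<gamma> \<delta> by simp
  ultimately have K_pos: "0 < real K"
    by linarith
  define \<eta> where "\<eta> = \<delta> / (2 * real K)"
  have \<eta>: "0 < \<eta>" "\<eta> \<le> \<gamma> / 16" "\<delta> / 2 = real K * \<eta>"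
    using K_ge K_pos \<gamma> \<delta> by (auto simp: \<eta>_def field_simps)
  obtain h where h: "h \<in> o(\<lambda>n. log 2 (real n))" and succ: "\<forall>\<^sub>F n in sequentially.
        1/2 \<le> measure_pmf.prob (random_graph n)
          {E. \<exists>C \<subseteq> {..<n}. is_clique (revealed_graph (A n) E 2) C \<and>
                real (card C) \<ge> \<alpha> * log 2 (real n) - h n}"
    using alg unfolding clique_algorithm_def by blast
  have log_lim: "filterlim (\<lambda>n. log 2 (real n)) at_top sequentially"
    by real_asymp
  have "0 < (\<gamma>/8)\<^sup>2 / 2"
    using \<gamma> by simp
  then have lim: "((\<lambda>n. (real K + 2) * 2 powr (2 * log 2 (real n) - (\<gamma>/8)\<^sup>2 / 2 * (log 2 (real n))\<^sup>2)
       + real K * (2 * log 2 (real n) + 2) ^ 5 * 2 powr (3 * log 2 (real n) + 1 - \<gamma> / 3 * (log 2 (real n))\<^sup>2))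
       \<longlongrightarrow> 0) sequentially"
    by (rule filterlim_compose[OF first_moment_bound_tendsto_0 log_lim]) (use \<gamma> K_pos in auto)
  have "\<forall>\<^sub>F n in sequentially. norm (h n) \<le> \<gamma> * norm (log 2 (real n))"
    by (rule landau_o.smallD[OF h \<gamma>(1)])
  moreover have "\<forall>\<^sub>F n in sequentially. (real K + 2) * 2 powr (2 * log 2 (real n) - (\<gamma>/8)\<^sup>2 / 2 * (log 2 (real n))\<^sup>2)
       + real K * (2 * log 2 (real n) + 2) ^ 5 * 2 powr (3 * log 2 (real n) + 1 - \<gamma> / 3 * (log 2 (real n))\<^sup>2) < 1/2"
    by (rule order_tendstoD(2)[OF lim]) simp
  moreover have "\<forall>\<^sub>F n in sequentially. 24 \<le> \<gamma> * log 2 (real n)"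
    using \<gamma> by real_asymp
  moreover have "\<forall>\<^sub>F n in sequentially. 2 \<le> real n powr \<eta>"
    using \<eta> by real_asymp
  moreover have "\<forall>\<^sub>F n in sequentially. 2 * log 2 (real n) + 1 \<le> real n powr \<eta>"
    using \<eta> by real_asymp
  moreover note succ eventually_ge_at_top[of "2::nat"]
  ultimately have "\<forall>\<^sub>F n in sequentially. False"
  proof eventually_elim
    case (elim n)
    interpret two_rounds n \<delta> "A n []" "\<lambda>F. A n [(A n [], F)]"
      using clique_algorithm_two_rounds[OF alg \<delta>] elim by blast
    define k where "k = nat \<lceil>(4/3 * \<delta> + \<gamma>) * N\<rceil>"
    have k1: "(4/3 * \<delta> + \<gamma>) * N \<le> real k"
      unfolding k_def by (rule real_nat_ceiling_ge)
    have k2: "real k \<le> (4/3 * \<delta> + \<gamma>) * N + 1"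
    proof -
      have "0 \<le> (4/3 * \<delta> + \<gamma>) * N"
        using \<gamma> \<delta> N_ge_1 by simp
      then show ?thesis
        unfolding k_def using of_int_ceiling_le_add_one[of "(4/3 * \<delta> + \<gamma>) * N"] by simp
    qed
    have "(4/3 * \<delta> + \<gamma>) * N \<le> 2 * N"
      using \<gamma> N_ge_1 by (intro mult_right_mono) auto
    then have k3: "real k \<le> real n powr \<eta>"
      using k2 elim by linarith
    let ?S = "{E. \<exists>C \<subseteq> {..<n}. is_clique (revealed_graph (A n) E 2) C \<and>
                real (card C) \<ge> \<alpha> * log 2 (real n) - h n}"
    have fin: "finite (vertex_pairs n)"
      by (simp add: vertex_pairs_eq)
    have set: "set_pmf (random_graph n) = Pow (vertex_pairs n)"
      unfolding random_graph_eq by (rule set_pmf_of_set) (use fin in auto)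
    \<comment> \<open>On the support of the random graph, the promised clique is trimmed to exactly
      \<open>k\<close> vertices.\<close>
    have sub: "?S \<inter> Pow (vertex_pairs n) \<subseteq> found_clique k"
    proof
      fix E assume E: "E \<in> ?S \<inter> Pow (vertex_pairs n)"
      then obtain C where C: "C \<subseteq> {..<n}" "is_clique (revealed_graph (A n) E 2) C"
          "\<alpha> * N - h n \<le> real (card C)"
        by auto
      have "h n \<le> \<gamma> * N"
        using elim(1) N_ge_1 by simp
      then have "(4/3 * \<delta> + \<gamma>) * N \<le> real (card C)"
        using C(3) by (simp add: \<gamma>_def field_simps)
      then have "k \<le> card C"
        by (simp add: k_def ceiling_le_iff)
      then obtain D where D: "D \<subseteq> C" "card D = k"
        by (metis obtain_subset_with_card_n)
      have "pairs_in D \<subseteq> revealed_graph (A n) E 2"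
        using C(2) D(1) by (auto simp: pairs_in_def card_2_iff is_clique_def)
      then show "E \<in> found_clique k"
        using E C(1) D unfolding found_clique_def revealed_graph_2
        by (intro CollectI conjI exI[of _ D]) auto
    qed
    have "1/2 \<le> measure_pmf.prob (random_graph n) (?S \<inter> set_pmf (random_graph n))"
      using elim by (simp add: measure_Int_set_pmf)
    also have "\<dots> \<le> measure_pmf.prob (random_graph n) (found_clique k)"
      unfolding set by (rule measure_pmf.finite_measure_mono[OF sub]) simp
    also have "\<dots> < 1/2"
      using prob_found_clique_le[OF \<gamma> \<eta>(3,1,2) k1 k2] k3 elim by simp
    finally show False
      by simp
  qed
  then show False
    by simp
qed

theorem theorem1:
  fixes \<delta> :: real
  assumes "1 \<le> \<delta>" and "\<delta> < 2"
  shows "alpha_star_uniform \<delta> 2 \<le> 4 / 3 * \<delta>"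
proof -
  \<comment> \<open>The algorithm that queries nothing shows that the supremum is over a nonempty
    set, as \<open>cSup_least\<close> requires.\<close>
  have "clique_algorithm (replicate 2 \<delta>) 2 0 (\<lambda>_ _. {})"
    using assms by (intro clique_algorithm_zero) auto
  then have "{\<alpha>. \<exists>A. clique_algorithm (replicate 2 \<delta>) 2 \<alpha> A} \<noteq> {}"
    by blast
  then show ?thesis
    unfolding alpha_star_uniform_def alpha_star_def
    by (rule cSup_least) (use clique_algorithm_le assms in blast)
qed

end
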